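(* The Rothstein family of any supermanifold is generically isotrivial. That is, if $(\mathcal U\to\mathcal X\to\mathbb C)$ is the Rothstein family associated to a supermanifold $(\mathfrak U\to\mathfrak X)$ and $s$ is its characteristic section, then the fibers $(\mathcal U\to\mathcal X)_t$ and $(\mathcal U\to\mathcal X)_{t'}$ are isomorphic as supermanifolds for all $t,t'\in\mathbb C$ with $s(t)\neq0$ and $s(t')\neq0$.
   Context: A model $(X,T^*_{X,-})$ is a complex manifold $X$ with a holomorphic vector bundle $T^*_{X,-}$. A supermanifold $(\mathfrak U\to\mathfrak X)$ modelled on $(X,T^*_{X,-})$ of splitting type $j>1$ is a 1-cocycle representative of a class in $\check H^1(X,\mathcal G^{(j)}_{T^*_{X,-}})$, where $\mathcal G^{(j)}_{T^*_{X,-}}$ is the sheaf of parity-preserving automorphisms of $\wedge^\bullet T^*_{X,-}$ that are the identity modulo $\bigoplus_{k\ge j}\wedge^kT^*_{X,-}$. Equivalently it is a locally ringed space $\mathfrak X$ with reduced space $X$ and structure sheaf locally isomorphic to $\wedge^\bullet T^*_{X,-}$, with a cover $(\mathfrak U_\alpha)$ by split pieces with even and odd coordinates $(x|\theta)$, where open sets $\mathfrak U_{\alpha\beta}\subset\mathfrak U_\alpha$ are glued to $\mathfrak U_{\beta\alpha}\subset\mathfrak U_\beta$ by transition functions $$\rho_{\alpha\beta}(x|\theta)=f_{\alpha\beta}(x)+\zeta_{\alpha\beta}(x)\theta+h_{\alpha\beta}(x)\theta^j+O(\theta^{j+1}).$$ Here $f_{\alpha\beta}$ are the transition functions of $X$,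 $\zeta_{\alpha\beta}$ are those of $T^*_{X,-}$ (and $\zeta_{\alpha\beta}(x)\theta$ is linear in $\theta$), $h_{\alpha\beta}(x)\theta^j=\sum_{|I|=j}h^I_{\alpha\beta}(x)\theta_I$ over multi-indices $I$, and $O(\theta^{j+1})$ denotes terms proportional to $\theta^\ell$ with $\ell>j$. The obstruction to splitting $(\mathfrak U\to\mathfrak X)$ is the image $\omega$ of its class in $H^1(X,\mathcal A^{(j)}_{T^*_{X,-}})$, where $\mathcal A^{(j)}_{T^*_{X,-}}=\mathcal G^{(j)}_{T^*_{X,-}}/\mathcal G^{(j+1)}_{T^*_{X,-}}$ is $\mathcal Hom(T^*_X,\wedge^jT^*_{X,-})$ for $j$ even and $\mathcal Hom(T^*_{X,-},\wedge^jT^*_{X,-})$ for $j$ odd. Rothstein family: modify $\rho$ by $x\mapsto x$, $\theta\mapsto\theta$, $\theta^j\mapsto t^j\theta^j$ for $t\in\mathbb C$, giving $$\vartheta_{\alpha\beta}(x,t|\theta)=f_{\alpha\beta}(x)+\zeta_{\alpha\beta}(x)\theta+t^jh_{\alpha\beta}(x)\theta^j+O(t^{j+1}\theta^{j+1}),$$ where the terms of $\rho_{\alpha\beta}$ of degree $k>j$ in $\theta$ are correspondingly scaled by $t^k$. These glue $\mathfrak U_{\alpha\beta}\times\mathbb C\subset\mathcal U_\alpha$ to $\mathfrak U_{\beta\alpha}\times\mathbb C\subset\mathcal U_\beta$, where $\mathcal U_\alpha=\mathfrak U_\alpha\times\mathbb C$ and $t$ is a global coordinate on $\mathbb C$. With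 the cover $\mathcal U=(\mathcal U_\alpha)$, the resulting $\mathcal X$ and the projection $(x,t|\theta)\mapsto t$, this is the Rothstein family $(\mathcal U\to\mathcal X\to\mathbb C)$ associated to $(\mathfrak U\to\mathfrak X)$. Its total space is modelled on $(X\times\mathbb C,p_X^*T^*_{X,-})$, with $p_X$ the projection to $X$. The obstruction class of its fiber over $t$ is $t^j\omega$ (the splitting type differential of the family), its characteristic section is $s:t\mapsto t^j$, the fiber over $t=1$ is $(\mathfrak U\to\mathfrak X)$, and the fiber over $t=0$ is the split model. Characteristic section and generic isotriviality in general: for an analytic family over a Stein base $B$ whose total space is modelled on $(X\times B,p_X^*T^*_{X,-})$ and has splitting type $j'$, the obstruction class of the fiber over $t\in B$ is $s(t)\,\omega'$ for some $\omega'\in H^1(X,\mathcal A^{(j')}_{T^*_{X,-}})$ and a global section $s\in H^0(B,\mathcal O_B)$, called the characteristic section. The family is generically isotrivial if all its fibers outside the zero locus of $s$ are isomorphic as supermanifolds.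
   Formalization: Degree-k terms are scaled by t^k only in even components and by t^(k-1) in odd ones, since scaling odd components by t^k breaks the cocycle condition in general; accordingly the characteristic section is t^j for j even and t^(j-1) for j odd. *)

theory Defs
  imports "HOL-Analysis.Analysis"
begin

section \<open>Superfunctions\<close>

text \<open>
  The space \<open>\<complex>\<^sup>p\<close> is realised inside \<open>nat \<Rightarrow> complex\<close>, as \<open>Euclidean_space\<close> does for
  \<open>\<real>\<^sup>n\<close>, so that \<open>p = 0\<close> and \<open>q = 0\<close> are allowed and \<open>p\<close> can be replaced by \<open>p + 1\<close>.
  Elements of the exterior algebra on \<open>\<theta>\<^sub>0, \<dots>\<close> are given by their coefficients with
  respect to the monomials \<open>\<theta>\<^sub>I\<close>, the product of the \<open>\<theta>\<^sub>a\<close> (\<open>a \<in> I\<close>) in increasing order.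
\<close>

type_synonym point = "nat \<Rightarrow> complex"
type_synonym grassmann = "nat set \<Rightarrow> complex"
type_synonym superfun = "nat set \<Rightarrow> point \<Rightarrow> complex"

definition Cn :: "nat \<Rightarrow> point set" where
  "Cn p = {x. \<forall>i\<ge>p. x i = 0}"

text \<open>Continuous and separately holomorphic; by Osgood's lemma this is holomorphy in several
  variables on sets \<open>V\<close> that are open in \<open>Cn p\<close>.\<close>

definition multi_holomorphic :: "nat \<Rightarrow> point set \<Rightarrow> (point \<Rightarrow> complex) \<Rightarrow> bool" where
  "multi_holomorphic p V f \<longleftrightarrow>
     continuous_on V f \<and>
     (\<forall>x\<in>V. \<forall>i<p. (\<lambda>z. f (x(i := z))) field_differentiable at (x i))"

definition partial :: "nat \<Rightarrow> (point \<Rightarrow> complex) \<Rightarrow> point \<Rightarrow> complex" where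
  "partial i f x = deriv (\<lambda>z. f (x(i := z))) (x i)"

definition multi_partial :: "nat \<Rightarrow> (nat \<Rightarrow> nat) \<Rightarrow> (point \<Rightarrow> complex) \<Rightarrow> point \<Rightarrow> complex" where
  "multi_partial p k f = foldr (\<lambda>i. partial i ^^ k i) [0..<p] f"

definition koszul_sign :: "nat set \<Rightarrow> nat set \<Rightarrow> complex" where
  "koszul_sign J K = (- 1) ^ card {(a, b). a \<in> J \<and> b \<in> K \<and> b < a}"

definition gmul :: "grassmann \<Rightarrow> grassmann \<Rightarrow> grassmann" where
  "gmul u v I = (\<Sum>J\<in>Pow I. koszul_sign J (I - J) * u J * v (I - J))"

definition gone :: grassmann where
  "gone I = (if I = {} then 1 else 0)"

definition gprod :: "grassmann list \<Rightarrow> grassmann" where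
  "gprod us = foldr gmul us gone"

text \<open>Sections of the split structure sheaf over \<open>V \<subseteq> \<complex>\<^sup>p\<close> with \<open>q\<close> odd coordinates.
  They are extended by zero, so that equality of functions is equality of sections.\<close>

definition superfuns :: "nat \<Rightarrow> nat \<Rightarrow> point set \<Rightarrow> superfun set" where
  "superfuns p q V =
     {F. (\<forall>I x. F I x \<noteq> 0 \<longrightarrow> I \<subseteq> {..<q} \<and> x \<in> V) \<and> (\<forall>I\<subseteq>{..<q}. multi_holomorphic p V (F I))}"

text \<open>A map of split superdomains is given by the pullbacks of the even coordinates \<open>Inl i\<close>
  and of the odd coordinates \<open>Inr a\<close> of the target.\<close>

type_synonym supermap = "nat + nat \<Rightarrow> superfun"

definition coords :: "nat \<Rightarrow> nat \<Rightarrow> (nat + nat) set" where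
  "coords p q = Inl ` {..<p} \<union> Inr ` {..<q}"

definition parity_preserving :: "nat \<Rightarrow> nat \<Rightarrow> supermap \<Rightarrow> bool" where
  "parity_preserving p q r \<longleftrightarrow>
     (\<forall>c\<in>coords p q. \<forall>I x. r c I x \<noteq> 0 \<longrightarrow> (even (card I) \<longleftrightarrow> isl c))"

definition body :: "nat \<Rightarrow> supermap \<Rightarrow> point \<Rightarrow> point" where
  "body p r x = (\<lambda>i. if i < p then r (Inl i) {} x else 0)"

definition soul :: "(nat set \<Rightarrow> complex) \<Rightarrow> grassmann" where
  "soul u I = (if I = {} then 0 else u I)"

text \<open>Substitution of a supermap \<open>r\<close> into a superfunction \<open>F\<close>: with \<open>f\<close> the body of \<open>r\<close> and
  \<open>n\<^sub>i\<close> the soul of its \<open>i\<close>-th even component, the value at \<open>x\<close> is the Taylor expansion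
  \<open>\<Sum>\<^sub>J \<Sum>\<^sub>k (\<partial>\<^sup>k F\<^sub>J) (f x) / k! \<cdot> n\<^sup>k \<cdot> r\<^sub>J\<close> where \<open>r\<^sub>J\<close> is the ordered product of the odd components
  \<open>r (Inr a)\<close>, \<open>a \<in> J\<close>. As the \<open>n\<^sub>i\<close> have degree at least two when \<open>r\<close> preserves parity,
  truncating at total order \<open>q\<close> loses nothing.\<close>

definition multi_indices :: "nat \<Rightarrow> nat \<Rightarrow> (nat \<Rightarrow> nat) set" where
  "multi_indices p q = {k. (\<forall>i\<ge>p. k i = 0) \<and> (\<Sum>i<p. k i) \<le> q}"

definition pull :: "nat \<Rightarrow> nat \<Rightarrow> supermap \<Rightarrow> superfun \<Rightarrow> superfun" where
  "pull p q r F I x =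
     (\<Sum>J\<in>Pow {..<q}. \<Sum>k\<in>multi_indices p q.
        multi_partial p k (F J) (body p r x) / (\<Prod>i<p. fact (k i)) *
        gmul
          (gprod (concat (map (\<lambda>i. replicate (k i) (soul (\<lambda>K. r (Inl i) K x))) [0..<p])))
          (gprod (map (\<lambda>a K. r (Inr a) K x) (sorted_list_of_set J))) I)"


section \<open>Supermanifolds\<close>

text \<open>A supermanifold is presented by its reduced space with an atlas \<open>(patch, chart)\<close> and
  the transition maps \<open>transition \<alpha> \<beta>\<close>, which express the coordinates of the \<open>\<beta>\<close>-th piece in
  those of the \<open>\<alpha>\<close>-th one. The transition functions of the reduced manifold and of
  its odd cotangent bundle are the parts of \<open>transition \<alpha> \<beta>\<close> of degree zero and one.\<close>

record ('x, 'a) supermfd =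
  evdim :: nat
  oddim :: nat
  reduced_space :: "'x topology"
  indices :: "'a set"
  patch :: "'a \<Rightarrow> 'x set"
  chart :: "'a \<Rightarrow> 'x \<Rightarrow> point"
  transition :: "'a \<Rightarrow> 'a \<Rightarrow> supermap"

definition overlap :: "('x, 'a) supermfd \<Rightarrow> 'a \<Rightarrow> 'a \<Rightarrow> point set" where
  "overlap M \<alpha> \<beta> = chart M \<alpha> ` (patch M \<alpha> \<inter> patch M \<beta>)"

definition complex_atlas :: "('x, 'a) supermfd \<Rightarrow> bool" where
  "complex_atlas M \<longleftrightarrow>
     Hausdorff_space (reduced_space M) \<and>
     topspace (reduced_space M) = (\<Union>\<alpha>\<in>indices M. patch M \<alpha>) \<and>
     (\<forall>\<alpha>\<in>indices M.
        openin (reduced_space M) (patch M \<alpha>) \<and>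
        openin (top_of_set (Cn (evdim M))) (chart M \<alpha> ` patch M \<alpha>) \<and>
        homeomorphic_map (subtopology (reduced_space M) (patch M \<alpha>))
          (top_of_set (chart M \<alpha> ` patch M \<alpha>)) (chart M \<alpha>))"

text \<open>Since \<open>transition\<close> has holomorphic components, the condition on bodies makes the
  changes of coordinates \<open>chart M \<beta> \<circ> (chart M \<alpha>)\<^sup>-\<^sup>1\<close> holomorphic.\<close>

definition supermanifold :: "('x, 'a) supermfd \<Rightarrow> bool" where
  "supermanifold M \<longleftrightarrow>
     complex_atlas M \<and>
     (\<forall>\<alpha>\<in>indices M. \<forall>\<beta>\<in>indices M.
        (\<forall>c\<in>coords (evdim M) (oddim M).
           transition M \<alpha> \<beta> c \<in> superfuns (evdim M) (oddim M) (overlap M \<alpha> \<beta>)) \<and>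
        parity_preserving (evdim M) (oddim M) (transition M \<alpha> \<beta>) \<and>
        (\<forall>y\<in>patch M \<alpha> \<inter> patch M \<beta>. body (evdim M) (transition M \<alpha> \<beta>) (chart M \<alpha> y) = chart M \<beta> y)) \<and>
     (\<forall>\<alpha>\<in>indices M. \<forall>x\<in>chart M \<alpha> ` patch M \<alpha>. \<forall>I.
        (\<forall>i<evdim M. transition M \<alpha> \<alpha> (Inl i) I x = (if I = {} then x i else 0)) \<and>
        (\<forall>a<oddim M. transition M \<alpha> \<alpha> (Inr a) I x = (if I = {a} then 1 else 0))) \<and>
     (\<forall>\<alpha>\<in>indices M. \<forall>\<beta>\<in>indices M. \<forall>\<gamma>\<in>indices M.
        \<forall>x\<in>chart M \<alpha> ` (patch M \<alpha> \<inter> patch M \<beta> \<inter> patch M \<gamma>).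
        \<forall>c\<in>coords (evdim M) (oddim M). \<forall>I.
          transition M \<alpha> \<gamma> c I x = pull (evdim M) (oddim M) (transition M \<alpha> \<beta>) (transition M \<beta> \<gamma> c) I x)"

text \<open>Splitting type \<open>j\<close>: between the linear part and degree \<open>j\<close> nothing occurs.\<close>

definition splitting_type :: "('x, 'a) supermfd \<Rightarrow> nat \<Rightarrow> bool" where
  "splitting_type M j \<longleftrightarrow>
     (\<forall>\<alpha>\<in>indices M. \<forall>\<beta>\<in>indices M. \<forall>c\<in>coords (evdim M) (oddim M). \<forall>I x.
        1 < card I \<and> card I < j \<longrightarrow> transition M \<alpha> \<beta> c I x = 0)"


subsection \<open>The structure sheaf and isomorphisms\<close>

text \<open>A section over an open set \<open>W\<close> of the reduced space is a family of superfunctions on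
  the pieces, matched by the transition maps.\<close>

type_synonym 'a sheaf_section = "'a \<Rightarrow> superfun"

definition sections :: "('x, 'a) supermfd \<Rightarrow> 'x set \<Rightarrow> 'a sheaf_section set" where
  "sections M W =
     {s. (\<forall>\<alpha>. \<alpha> \<notin> indices M \<longrightarrow> s \<alpha> = (\<lambda>I x. 0)) \<and>
         (\<forall>\<alpha>\<in>indices M. s \<alpha> \<in> superfuns (evdim M) (oddim M) (chart M \<alpha> ` (W \<inter> patch M \<alpha>))) \<and>
         (\<forall>\<alpha>\<in>indices M. \<forall>\<beta>\<in>indices M. \<forall>x\<in>chart M \<alpha> ` (W \<inter> patch M \<alpha> \<inter> patch M \<beta>). \<forall>I.
            s \<alpha> I x = pull (evdim M) (oddim M) (transition M \<alpha> \<beta>) (s \<beta>) I x)}"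

definition restrict_section :: "('x, 'a) supermfd \<Rightarrow> 'x set \<Rightarrow> 'a sheaf_section \<Rightarrow> 'a sheaf_section" where
  "restrict_section M W s = (\<lambda>\<alpha> I x. if x \<in> chart M \<alpha> ` (W \<inter> patch M \<alpha>) then s \<alpha> I x else 0)"

definition section_add :: "'a sheaf_section \<Rightarrow> 'a sheaf_section \<Rightarrow> 'a sheaf_section" where
  "section_add s r = (\<lambda>\<alpha> I x. s \<alpha> I x + r \<alpha> I x)"

definition section_scale :: "complex \<Rightarrow> 'a sheaf_section \<Rightarrow> 'a sheaf_section" where
  "section_scale z s = (\<lambda>\<alpha> I x. z * s \<alpha> I x)"

definition section_mult :: "'a sheaf_section \<Rightarrow> 'a sheaf_section \<Rightarrow> 'a sheaf_section" where
  "section_mult s r = (\<lambda>\<alpha> I x. gmul (\<lambda>J. s \<alpha> J x) (\<lambda>J. r \<alpha> J x) I)"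

definition section_one :: "('x, 'a) supermfd \<Rightarrow> 'x set \<Rightarrow> 'a sheaf_section" where
  "section_one M W =
     (\<lambda>\<alpha> I x. if \<alpha> \<in> indices M \<and> x \<in> chart M \<alpha> ` (W \<inter> patch M \<alpha>) then gone I else 0)"

definition even_section :: "'a sheaf_section \<Rightarrow> bool" where
  "even_section s \<longleftrightarrow> (\<forall>\<alpha> I x. s \<alpha> I x \<noteq> 0 \<longrightarrow> even (card I))"

definition odd_section :: "'a sheaf_section \<Rightarrow> bool" where
  "odd_section s \<longleftrightarrow> (\<forall>\<alpha> I x. s \<alpha> I x \<noteq> 0 \<longrightarrow> odd (card I))"

text \<open>An isomorphism of locally ringed spaces: a homeomorphism \<open>\<Phi>\<close> of reduced spaces
  with an isomorphism \<open>\<psi>\<close> from the structure sheaf of \<open>N\<close> to the direct image of the one of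
  \<open>M\<close>, as sheaves of \<open>\<int>/2\<close>-graded \<open>\<complex>\<close>-algebras. It is local automatically, and it
  need not induce the identity on reduced spaces or odd cotangent bundles.\<close>

definition supermanifold_isomorphism ::
  "('x, 'a) supermfd \<Rightarrow> ('y, 'b) supermfd \<Rightarrow> ('x \<Rightarrow> 'y) \<Rightarrow>
     ('y set \<Rightarrow> 'b sheaf_section \<Rightarrow> 'a sheaf_section) \<Rightarrow> bool" where
  "supermanifold_isomorphism M N \<Phi> \<psi> \<longleftrightarrow>
     homeomorphic_map (reduced_space M) (reduced_space N) \<Phi> \<and>
     (\<forall>W. openin (reduced_space N) W \<longrightarrow>
        (let V = {x \<in> topspace (reduced_space M). \<Phi> x \<in> W} in
         bij_betw (\<psi> W) (sections N W) (sections M V) \<and>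
         \<psi> W (section_one N W) = section_one M V \<and>
         (\<forall>s\<in>sections N W. \<forall>r\<in>sections N W.
            \<psi> W (section_add s r) = section_add (\<psi> W s) (\<psi> W r) \<and>
            \<psi> W (section_mult s r) = section_mult (\<psi> W s) (\<psi> W r)) \<and>
         (\<forall>s\<in>sections N W. \<forall>z. \<psi> W (section_scale z s) = section_scale z (\<psi> W s)) \<and>
         (\<forall>s\<in>sections N W. (even_section s \<longrightarrow> even_section (\<psi> W s)) \<and>
                           (odd_section s \<longrightarrow> odd_section (\<psi> W s))))) \<and>
     (\<forall>W W'. openin (reduced_space N) W \<and> openin (reduced_space N) W' \<and> W' \<subseteq> W \<longrightarrow>
        (\<forall>s\<in>sections N W.
           \<psi> W' (restrict_section N W' s) =
           restrict_section M {x \<in> topspace (reduced_space M). \<Phi> x \<in> W'} (\<psi> W s)))"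

definition isomorphic_supermanifolds :: "('x, 'a) supermfd \<Rightarrow> ('y, 'b) supermfd \<Rightarrow> bool" where
  "isomorphic_supermanifolds M N \<longleftrightarrow>
     supermanifold M \<and> supermanifold N \<and> (\<exists>\<Phi> \<psi>. supermanifold_isomorphism M N \<Phi> \<psi>)"


section \<open>Obstruction classes\<close>

text \<open>
  Cochains with values in \<open>\<A>\<^sup>(\<^sup>j\<^sup>)\<close> on the cover of the atlas, written in coordinates: over
  \<open>patch M \<alpha> \<inter> patch M \<beta>\<close> a section is given by its components along the coordinate vector
  fields \<open>\<partial>/\<partial>x\<^sub>i\<close> (\<open>Inl i\<close>) and \<open>\<partial>/\<partial>\<theta>\<^sub>a\<close> (\<open>Inr a\<close>) of the \<open>\<beta>\<close>-th piece, as polynomials in the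
  \<open>\<theta>\<close> of the \<open>\<alpha>\<close>-th one. By parity only the \<open>Inl\<close> components can be non-zero for \<open>j\<close> even, and only
  the \<open>Inr\<close> components for \<open>j\<close> odd.
\<close>

definition A_section :: "('x, 'a) supermfd \<Rightarrow> nat \<Rightarrow> point set \<Rightarrow> supermap \<Rightarrow> bool" where
  "A_section M j V w \<longleftrightarrow>
     parity_preserving (evdim M) (oddim M) w \<and>
     (\<forall>c\<in>coords (evdim M) (oddim M).
        w c \<in> superfuns (evdim M) (oddim M) V \<and> (\<forall>I x. w c I x \<noteq> 0 \<longrightarrow> card I = j))"

definition obstruction :: "('x, 'a) supermfd \<Rightarrow> nat \<Rightarrow> 'a \<Rightarrow> 'a \<Rightarrow> supermap" where
  "obstruction M j \<alpha> \<beta> = (\<lambda>c I x. if card I = j then transition M \<alpha> \<beta> c I x else 0)"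

text \<open>The split part \<open>(x, \<theta>) \<mapsto> (f x, \<zeta> x \<theta>)\<close> of a transition map.\<close>

definition split_part :: "supermap \<Rightarrow> supermap" where
  "split_part r = (\<lambda>c I x. if I = {} \<or> card I = 1 then r c I x else 0)"

text \<open>Change of frame of a vector field along the split part:
  \<open>\<partial>f\<^sub>i/\<partial>x\<^sub>k\<close> on even components, \<open>\<zeta>\<close> on odd ones.\<close>

definition push :: "nat \<Rightarrow> nat \<Rightarrow> supermap \<Rightarrow> supermap \<Rightarrow> supermap" where
  "push p q r w = (\<lambda>c I x. case c of
       Inl i \<Rightarrow> (\<Sum>k<p. partial k (r (Inl i) {}) x * w (Inl k) I x)
     | Inr a \<Rightarrow> (\<Sum>b<q. r (Inr a) {b} x * w (Inr b) I x))"

text \<open>Equality of classes up to a coboundary on the cover of the atlas. As \<open>H\<^sup>1\<close> of a cover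
  injects into \<open>H\<^sup>1(X, \<A>\<^sup>(\<^sup>j\<^sup>))\<close>, for cocycles this is equality of classes there.\<close>

definition cohomologous ::
  "('x, 'a) supermfd \<Rightarrow> nat \<Rightarrow> ('a \<Rightarrow> 'a \<Rightarrow> supermap) \<Rightarrow> ('a \<Rightarrow> 'a \<Rightarrow> supermap) \<Rightarrow> bool" where
  "cohomologous M j h h' \<longleftrightarrow>
     (\<forall>\<alpha>\<in>indices M. \<forall>\<beta>\<in>indices M.
        A_section M j (overlap M \<alpha> \<beta>) (h \<alpha> \<beta>) \<and> A_section M j (overlap M \<alpha> \<beta>) (h' \<alpha> \<beta>)) \<and>
     (\<exists>w. (\<forall>\<alpha>\<in>indices M. A_section M j (chart M \<alpha> ` patch M \<alpha>) (w \<alpha>)) \<and>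
       (\<forall>\<alpha>\<in>indices M. \<forall>\<beta>\<in>indices M. \<forall>c\<in>coords (evdim M) (oddim M).
          \<forall>x\<in>overlap M \<alpha> \<beta>. \<forall>I.
            h' \<alpha> \<beta> c I x = h \<alpha> \<beta> c I x
              + pull (evdim M) (oddim M) (split_part (transition M \<alpha> \<beta>)) (w \<beta> c) I x
              - push (evdim M) (oddim M) (transition M \<alpha> \<beta>) (w \<alpha>) c I x))"


section \<open>Families over the complex line\<close>

text \<open>The projection of a family to \<open>\<complex>\<close> is understood to be the last even coordinate of
  every chart of the total space. The fiber over \<open>t\<close> is obtained by setting it to \<open>t\<close>.\<close>

record ('x, 'a) superfamily =
  total_space :: "('x, 'a) supermfd"
  proj :: "'x \<Rightarrow> complex"

definition fiber :: "('x, 'a) superfamily \<Rightarrow> complex \<Rightarrow> ('x, 'a) supermfd" where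
  "fiber F t = (let N = total_space F; p = evdim N - 1 in
     \<lparr>evdim = p,
      oddim = oddim N,
      reduced_space = subtopology (reduced_space N) {y. proj F y = t},
      indices = indices N,
      patch = (\<lambda>\<alpha>. patch N \<alpha> \<inter> {y. proj F y = t}),
      chart = (\<lambda>\<alpha> y. (chart N \<alpha> y)(p := 0)),
      transition = (\<lambda>\<alpha> \<beta> c I x. if x p = 0 then transition N \<alpha> \<beta> c I (x(p := t)) else 0)\<rparr>)"

text \<open>The cochain \<open>\<omega>\<close> is not required to be a cocycle: unless \<open>u\<close> vanishes identically it is one
  automatically, being up to a factor and a coboundary the obstruction cocycle of a fiber.\<close>

definition characteristic_section ::
  "('x, 'a) superfamily \<Rightarrow> nat \<Rightarrow> (complex \<Rightarrow> complex) \<Rightarrow> bool" where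
  "characteristic_section F j u \<longleftrightarrow>
     u holomorphic_on UNIV \<and>
     (\<exists>\<omega>. \<forall>t. cohomologous (fiber F t) j (obstruction (fiber F t) j)
                (\<lambda>\<alpha> \<beta> c I x. u t * \<omega> \<alpha> \<beta> c I x))"

definition generically_isotrivial ::
  "('x, 'a) superfamily \<Rightarrow> nat \<Rightarrow> (complex \<Rightarrow> complex) \<Rightarrow> bool" where
  "generically_isotrivial F j u \<longleftrightarrow>
     characteristic_section F j u \<and>
     (\<forall>t t'. u t \<noteq> 0 \<and> u t' \<noteq> 0 \<longrightarrow> isomorphic_supermanifolds (fiber F t) (fiber F t'))"


subsection \<open>The Rothstein family\<close>

text \<open>
  The terms of degree \<open>k\<close> in \<open>\<theta>\<close> are multiplied by \<open>t\<close> to the power \<open>2\<lfloor>k/2\<rfloor>\<close>, that is by \<open>t\<^sup>k\<close> in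
  the even components and by \<open>t\<^sup>k\<^sup>-\<^sup>1\<close> in the odd ones. For \<open>t \<noteq> 0\<close> this is conjugation by
  \<open>\<theta> \<mapsto> t \<theta>\<close>. Multiplying by \<open>t\<^sup>k\<close> in the odd components as well would not preserve the cocycle
  condition: \<open>x \<mapsto> x + \<theta>\<^sub>1\<theta>\<^sub>2\<close>, \<open>\<theta>\<^sub>3 \<mapsto> e\<^sup>x \<theta>\<^sub>3\<close> has inverse \<open>x \<mapsto> x - \<theta>\<^sub>1\<theta>\<^sub>2\<close>,
  \<open>\<theta>\<^sub>3 \<mapsto> e\<^sup>-\<^sup>x (\<theta>\<^sub>3 + \<theta>\<^sub>1\<theta>\<^sub>2\<theta>\<^sub>3)\<close>, and after scaling by \<open>t\<^sup>2\<close> and \<open>t\<^sup>3\<close> the two compose to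
  \<open>\<theta>\<^sub>3 \<mapsto> \<theta>\<^sub>3 + (t\<^sup>3 - t\<^sup>2) \<theta>\<^sub>1\<theta>\<^sub>2\<theta>\<^sub>3\<close>.
\<close>

definition rothstein_weight :: "nat \<Rightarrow> nat" where
  "rothstein_weight k = 2 * (k div 2)"

text \<open>Here \<open>y p\<close> is the coordinate \<open>t\<close>, and \<open>y(p := 0)\<close> is \<open>x\<close>.\<close>

definition rothstein_total :: "('x, 'a) supermfd \<Rightarrow> ('x \<times> complex, 'a) supermfd" where
  "rothstein_total M = (let p = evdim M in
     \<lparr>evdim = Suc p,
      oddim = oddim M,
      reduced_space = prod_topology (reduced_space M) euclidean,
      indices = indices M,
      patch = (\<lambda>\<alpha>. patch M \<alpha> \<times> UNIV),
      chart = (\<lambda>\<alpha> (m, t). (chart M \<alpha> m)(p := t)),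
      transition = (\<lambda>\<alpha> \<beta> c I y.
        if c = Inl p then (if I = {} \<and> y(p := 0) \<in> overlap M \<alpha> \<beta> then y p else 0)
        else y p ^ rothstein_weight (card I) * transition M \<alpha> \<beta> c I (y(p := 0)))\<rparr>)"

definition rothstein_family :: "('x, 'a) supermfd \<Rightarrow> ('x \<times> complex, 'a) superfamily" where
  "rothstein_family M = \<lparr>total_space = rothstein_total M, proj = snd\<rparr>"

text \<open>The factor by which the terms of degree \<open>j\<close> are multiplied; this is \<open>t\<^sup>j\<close> for \<open>j\<close> even and
  \<open>t\<^sup>j\<^sup>-\<^sup>1\<close> for \<open>j\<close> odd, and vanishes only at \<open>0\<close> when \<open>1 < j\<close>.\<close>

definition rothstein_section :: "nat \<Rightarrow> complex \<Rightarrow> complex" where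
  "rothstein_section j t = t ^ rothstein_weight j"

lemma rothstein_section_eq:
  "rothstein_section j t = (if even j then t ^ j else t ^ (j - 1))"
  by (auto simp: rothstein_section_def rothstein_weight_def elim!: evenE oddE)

lemma rothstein_section_nonzero:
  "1 < j \<Longrightarrow> rothstein_section j t \<noteq> 0 \<longleftrightarrow> t \<noteq> 0"
  by (auto simp: rothstein_section_def rothstein_weight_def)

lemma fiber_rothstein_simps [simp]:
  "evdim (fiber (rothstein_family M) t) = evdim M"
  "oddim (fiber (rothstein_family M) t) = oddim M"
  "indices (fiber (rothstein_family M) t) = indices M"
  "reduced_space (fiber (rothstein_family M) t) =
     subtopology (prod_topology (reduced_space M) euclidean) {y. snd y = t}"
  "patch (fiber (rothstein_family M) t) \<alpha> = patch M \<alpha> \<times> {t}"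
  by (auto simp: fiber_def rothstein_family_def rothstein_total_def Let_def)

lemma chart_image_subset:
  assumes "supermanifold M" "\<alpha> \<in> indices M"
  shows "chart M \<alpha> ` patch M \<alpha> \<subseteq> Cn (evdim M)"
proof -
  have "openin (top_of_set (Cn (evdim M))) (chart M \<alpha> ` patch M \<alpha>)"
    using assms by (simp add: supermanifold_def complex_atlas_def)
  then show ?thesis by (rule openin_imp_subset)
qed

text \<open>In the coordinates of the atlas, the fiber over \<open>t\<close> has the same charts as \<open>M\<close>, and its
  transition maps are the rescaled ones.\<close>

lemma
  assumes "supermanifold M" "\<alpha> \<in> indices M"
  shows chart_fiber_rothstein:
      "m \<in> patch M \<alpha> \<Longrightarrow> chart (fiber (rothstein_family M) t) \<alpha> (m, t') = chart M \<alpha> m"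
    and overlap_fiber_rothstein:
      "overlap (fiber (rothstein_family M) t) \<alpha> \<beta> = overlap M \<alpha> \<beta>"
proof -
  have *: "chart M \<alpha> m (evdim M) = 0" if "m \<in> patch M \<alpha>" for m
  proof -
    have "chart M \<alpha> m \<in> Cn (evdim M)"
      using chart_image_subset[OF assms] that by blast
    then show ?thesis by (auto simp: Cn_def)
  qed
  show c: "chart (fiber (rothstein_family M) t) \<alpha> (m, t') = chart M \<alpha> m" if "m \<in> patch M \<alpha>" for m t'
    using *[OF that]
    by (auto simp: fiber_def rothstein_family_def rothstein_total_def Let_def fun_upd_idem)
  show "overlap (fiber (rothstein_family M) t) \<alpha> \<beta> = overlap M \<alpha> \<beta>"
    unfolding overlap_def fiber_rothstein_simps
    by (force simp: c image_iff)
qed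

lemma transition_fiber_rothstein:
  assumes "supermanifold M" "\<alpha> \<in> indices M" "\<beta> \<in> indices M" "c \<in> coords (evdim M) (oddim M)"
  shows "transition (fiber (rothstein_family M) t) \<alpha> \<beta> c I x =
           t ^ rothstein_weight (card I) * transition M \<alpha> \<beta> c I x"
proof -
  have ne: "c \<noteq> Inl (evdim M)"
    using assms(4) by (auto simp: coords_def)
  have "transition M \<alpha> \<beta> c I x = 0" if "x (evdim M) \<noteq> 0"
  proof (rule ccontr)
    assume nz: "transition M \<alpha> \<beta> c I x \<noteq> 0"
    have "transition M \<alpha> \<beta> c \<in> superfuns (evdim M) (oddim M) (overlap M \<alpha> \<beta>)"
      using assms unfolding supermanifold_def by blast
    then have "x \<in> chart M \<alpha> ` patch M \<alpha>"
      using nz by (auto simp: superfuns_def overlap_def)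
    then show False
      using chart_image_subset[OF assms(1,2)] that by (auto simp: Cn_def)
  qed
  moreover have "x(evdim M := 0) = x" if "x (evdim M) = 0"
    using that by (simp add: fun_upd_idem)
  ultimately show ?thesis
    using ne by (auto simp: fiber_def rothstein_family_def rothstein_total_def Let_def)
qed

lemma multi_holomorphic_const [simp]: "multi_holomorphic p V (\<lambda>x. c)"
  by (simp add: multi_holomorphic_def)

lemma multi_holomorphic_cmult:
  "multi_holomorphic p V f \<Longrightarrow> multi_holomorphic p V (\<lambda>x. c * f x)"
  by (auto simp: multi_holomorphic_def intro!: continuous_intros field_differentiable_mult)

lemma partial_zero: "(partial i ^^ n) (\<lambda>x. 0) = (\<lambda>x. 0)"
proof (induction n)
  case (Suc n)
  then show ?case by (simp add: partial_def fun_eq_iff)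
qed simp

lemma multi_partial_zero: "multi_partial p k (\<lambda>x. 0) x = 0"
proof -
  have "foldr (\<lambda>i. partial i ^^ k i) is (\<lambda>x. 0) = (\<lambda>x. 0)" for "is"
    by (induction "is") (simp_all add: partial_zero)
  then show ?thesis by (simp add: multi_partial_def)
qed

lemma characteristic_section_rothstein:
  assumes M: "supermanifold M"
  shows "characteristic_section (rothstein_family M) j (rothstein_section j)"
  unfolding characteristic_section_def
proof (intro conjI exI allI)
  show "rothstein_section j holomorphic_on UNIV"
    unfolding rothstein_section_def by (intro holomorphic_intros)
next
  fix t
  let ?N = "fiber (rothstein_family M) t"
  have A: "A_section ?N j (overlap ?N \<alpha> \<beta>) (\<lambda>c I x. z * obstruction M j \<alpha> \<beta> c I x)"
    if "\<alpha> \<in> indices M" "\<beta> \<in> indices M" for \<alpha> \<beta> z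
  proof -
    have sf: "transition M \<alpha> \<beta> c \<in> superfuns (evdim M) (oddim M) (overlap M \<alpha> \<beta>)"
      if "c \<in> coords (evdim M) (oddim M)" for c
      using M \<open>\<alpha> \<in> indices M\<close> \<open>\<beta> \<in> indices M\<close> that unfolding supermanifold_def by blast
    have pp: "parity_preserving (evdim M) (oddim M) (transition M \<alpha> \<beta>)"
      using M that unfolding supermanifold_def by blast
    have hol: "multi_holomorphic (evdim M) (overlap M \<alpha> \<beta>) (\<lambda>x. obstruction M j \<alpha> \<beta> c I x)"
      if "c \<in> coords (evdim M) (oddim M)" "I \<subseteq> {..<oddim M}" for c I
      using sf[OF that(1)] that(2) by (cases "card I = j") (auto simp: obstruction_def superfuns_def)
    have nz: "transition M \<alpha> \<beta> c I x \<noteq> 0 \<and> card I = j" if "obstruction M j \<alpha> \<beta> c I x \<noteq> 0" for c I x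
      using that by (auto simp: obstruction_def split: if_splits)
    have "(\<lambda>I x. z * obstruction M j \<alpha> \<beta> c I x) \<in> superfuns (evdim M) (oddim M) (overlap M \<alpha> \<beta>)"
      if "c \<in> coords (evdim M) (oddim M)" for c
      using sf[OF that] nz[of c] hol[OF that]
      unfolding superfuns_def by (simp add: multi_holomorphic_cmult) blast
    moreover have "parity_preserving (evdim M) (oddim M) (\<lambda>c I x. z * obstruction M j \<alpha> \<beta> c I x)"
      using pp nz unfolding parity_preserving_def by fastforce
    ultimately show ?thesis
      using nz by (auto simp: A_section_def overlap_fiber_rothstein[OF M that(1)])
  qed
  have A0: "A_section ?N j V (\<lambda>c I x. 0)" for V
    by (auto simp: A_section_def superfuns_def parity_preserving_def)
  have eq: "obstruction ?N j \<alpha> \<beta> c I x = rothstein_section j t * obstruction M j \<alpha> \<beta> c I x"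
    if "\<alpha> \<in> indices M" "\<beta> \<in> indices M" "c \<in> coords (evdim M) (oddim M)" for \<alpha> \<beta> c I x
    using transition_fiber_rothstein[OF M that]
    by (auto simp: obstruction_def rothstein_section_def)
  have A1: "A_section ?N j (overlap ?N \<alpha> \<beta>) (obstruction ?N j \<alpha> \<beta>)"
    if "\<alpha> \<in> indices M" "\<beta> \<in> indices M" for \<alpha> \<beta>
  proof -
    have "obstruction ?N j \<alpha> \<beta> c = (\<lambda>I x. rothstein_section j t * obstruction M j \<alpha> \<beta> c I x)"
      if "c \<in> coords (evdim M) (oddim M)" for c
      using eq[OF \<open>\<alpha> \<in> indices M\<close> \<open>\<beta> \<in> indices M\<close> that] by (intro ext) simp
    with A[OF that, of "rothstein_section j t"] show ?thesis
      unfolding A_section_def parity_preserving_def by (simp cong: ball_cong) metis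
  qed
  have "pull p q r (\<lambda>I x. 0) I x = 0" for p q r I x
    by (simp add: pull_def multi_partial_zero)
  moreover have "push p q r (\<lambda>c I x. 0) c I x = 0" for p q r c I x
    by (simp add: push_def split: sum.split)
  ultimately show "cohomologous ?N j (obstruction ?N j)
      (\<lambda>\<alpha> \<beta> c I x. rothstein_section j t * obstruction M j \<alpha> \<beta> c I x)"
    unfolding cohomologous_def
    by (intro conjI exI[of _ "\<lambda>\<alpha> c I x. 0"]) (auto simp: A A0 A1 eq)
qed

end

theory Submission
  imports Defs "HOL-Complex_Analysis.Complex_Analysis"
begin

text \<open>For \<open>t \<noteq> 0\<close> the transition maps of the fiber over \<open>t\<close> are those of \<open>M\<close> conjugated by
  \<open>\<theta> \<mapsto> t \<theta>\<close>. Hence multiplying the coefficient of \<open>\<theta>\<^sub>I\<close> by \<open>(t / t')\<^bsup>|I|\<^esup>\<close> on every piece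
  carries sections of the fiber over \<open>t'\<close> to sections of the fiber over \<open>t\<close>. That substitution
  commutes with this rescaling needs the iterated partial derivatives to be homogeneous, and since
  \<open>deriv\<close> is an arbitrary value where the derivative does not exist, this requires that partial
  derivatives of holomorphic functions are again holomorphic.\<close>

section \<open>Partial derivatives of holomorphic functions of several variables\<close>

text \<open>A first-order Taylor expansion whose remainder is controlled by Cauchy's estimate for
  the second derivative. The bound depends on \<open>g\<close> only through \<open>B\<close> and
  \<open>r\<close>, which is what makes it uniform over a family of slices later.\<close>

lemma difference_quotient_error:
  assumes g: "g holomorphic_on ball 0 r" and B: "\<And>w. cmod w < r \<Longrightarrow> cmod (g w) \<le> B"
    and h: "h \<noteq> 0" "cmod h \<le> r / 4"
  shows "cmod ((g h - g 0) / h - deriv g 0) \<le> 32 * B / r\<^sup>2 * cmod h"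
proof -
  have r: "0 < r"
    using h by (smt (verit) norm_ge_zero divide_nonpos_pos zero_less_norm_iff)
  \<comment> \<open>The disc of radius \<open>r / 4\<close> around such an \<open>x\<close> stays
    within distance \<open>r / 2\<close> of the origin. Cauchy's inequality on it gives
    \<open>2 * B / (r / 4)^2 = 32 * B / r^2\<close>, the source of the constant 32.\<close>
  have bound: "cmod ((deriv ^^ 2) g x) \<le> fact 2 * B / (r / 4)\<^sup>2" if "x \<in> cball 0 (r / 4)" for x
  proof (rule Cauchy_inequality)
    have sub: "cball x (r / 4) \<subseteq> ball 0 r"
      using that r by (auto simp: subset_iff dist_norm norm_minus_commute)
        (smt (verit) field_sum_of_halves norm_triangle_sub norm_minus_commute)
    show "g holomorphic_on ball x (r / 4)"
      using g by (rule holomorphic_on_subset) (use sub ball_subset_cball in blast)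
    show "continuous_on (cball x (r / 4)) g"
      using g sub holomorphic_on_imp_continuous_on continuous_on_subset by blast
    show "cmod (g w) \<le> B" if "cmod (x - w) = r / 4" for w
      using sub that B[of w] by (auto simp: subset_iff dist_norm)
  qed (use r in auto)
  have "cmod ((deriv ^^ 0) g h - (\<Sum>i\<le>1. (deriv ^^ i) g 0 * (h - 0) ^ i / fact i))
      \<le> (fact 2 * B / (r / 4)\<^sup>2) * cmod (h - 0) ^ Suc 1 / fact 1"
  proof (rule complex_Taylor)
    show "((deriv ^^ i) g has_field_derivative (deriv ^^ Suc i) g x) (at x within cball 0 (r / 4))"
      if "x \<in> cball 0 (r / 4)" for i x
    proof -
      have "(deriv ^^ i) g holomorphic_on ball 0 r"
        using g by (simp add: holomorphic_higher_deriv)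
      then have "((deriv ^^ i) g has_field_derivative deriv ((deriv ^^ i) g) x) (at x)"
        by (rule holomorphic_derivI) (use that r in auto)
      then show ?thesis
        by (simp add: has_field_derivative_at_within)
    qed
  qed (use bound h r in \<open>auto simp: numeral_2_eq_2\<close>)
  then have "cmod (g h - g 0 - deriv g 0 * h) \<le> 32 * B / r\<^sup>2 * cmod h * cmod h"
    by (simp add: power2_eq_square algebra_simps)
  moreover have "(g h - g 0) / h - deriv g 0 = (g h - g 0 - deriv g 0 * h) / h"
    using h by (simp add: field_simps)
  ultimately show ?thesis
    using h by (simp add: norm_divide pos_divide_le_eq)
qed

lemma continuous_on_fun_upd:
  fixes g :: "'b::topological_space \<Rightarrow> 'i \<Rightarrow> 'c::topological_space"
  assumes "continuous_on S g" "continuous_on S u"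
  shows "continuous_on S (\<lambda>x. (g x)(i := u x))"
proof (rule continuous_on_coordinatewise_then_product)
  show "continuous_on S (\<lambda>x. ((g x)(i := u x)) j)" for j
    using assms by (cases "j = i") (auto intro: continuous_on_product_then_coordinatewise)
qed

lemma continuous_on_shift:
  fixes g :: "'b::topological_space \<Rightarrow> 'i \<Rightarrow> complex"
  assumes "continuous_on S g" "continuous_on S u"
  shows "continuous_on S (\<lambda>x. (g x)(i := g x i + u x))"
  by (rule continuous_on_fun_upd[OF assms(1)
        continuous_on_add[OF continuous_on_product_then_coordinatewise[OF assms(1)] assms(2)]])

lemma fun_upd_Cn: "x \<in> Cn p \<Longrightarrow> i < p \<Longrightarrow> x(i := z) \<in> Cn p"
  by (auto simp: Cn_def)

text \<open>\<open>multi_holomorphic\<close> gives differentiability of a slice only at the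
  coordinate of its own base point. Taking \<open>x(i := z)\<close> as the base point gives it at
  every \<open>z\<close>, because updating the same coordinate twice keeps only the second
  value.\<close>

lemma holomorphic_on_slice:
  assumes V: "openin (top_of_set (Cn p)) V" and f: "multi_holomorphic p V f"
    and i: "i < p" and x: "x \<in> Cn p"
  shows "open {z. x(i := z) \<in> V}" "(\<lambda>z. f (x(i := z))) holomorphic_on {z. x(i := z) \<in> V}"
proof -
  obtain U where U: "open U" "V = Cn p \<inter> U"
    using V by (auto simp: openin_open)
  have "{z. x(i := z) \<in> V} = (\<lambda>z. x(i := z)) -` U"
    using U fun_upd_Cn[OF x i] by auto
  moreover have "open ((\<lambda>z. x(i := z)) -` U)"
    by (intro open_vimage U continuous_on_fun_upd continuous_on_const continuous_on_id)
  ultimately show "open {z. x(i := z) \<in> V}" by simp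
  show "(\<lambda>z. f (x(i := z))) holomorphic_on {z. x(i := z) \<in> V}"
    unfolding holomorphic_on_def
  proof safe
    fix z assume z: "x(i := z) \<in> V"
    have "(\<lambda>w. f ((x(i := z))(i := w))) field_differentiable at ((x(i := z)) i)"
      using f z i unfolding multi_holomorphic_def by blast
    then show "(\<lambda>z. f (x(i := z))) field_differentiable at z within {z. x(i := z) \<in> V}"
      by (simp add: field_differentiable_at_within)
  qed
qed

text \<open>Continuity bounds \<open>f\<close> near \<open>x\<close>, and one bound and one radius
  then serve all slices through nearby points \<open>y\<close>. The one-variable estimate therefore
  has a constant \<open>K\<close> independent of \<open>y\<close>, so difference quotients converge
  uniformly on \<open>W \<inter> Cn p\<close>.\<close>

lemma partial_locally_uniform:
  assumes V: "openin (top_of_set (Cn p)) V" and f: "multi_holomorphic p V f"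
    and i: "i < p" and x: "x \<in> V"
  obtains W r K where "open W" "x \<in> W" "W \<inter> Cn p \<subseteq> V" "(0::real) < r"
    "\<And>y h. y \<in> W \<inter> Cn p \<Longrightarrow> cmod h < r \<Longrightarrow> y(i := y i + h) \<in> V"
    "\<And>y h. y \<in> W \<inter> Cn p \<Longrightarrow> h \<noteq> 0 \<Longrightarrow> cmod h < r \<Longrightarrow>
       cmod ((f (y(i := y i + h)) - f y) / h - partial i f y) \<le> K * cmod h"
proof -
  have VC: "V \<subseteq> Cn p" by (rule openin_imp_subset[OF V])
  have f_cont: "continuous_on V f"
    using f by (simp add: multi_holomorphic_def)
  let ?B = "cmod (f x) + 1"
  have "openin (top_of_set V) (V \<inter> f -` ball 0 ?B)"
    using f_cont by (rule continuous_openin_preimage_gen) simp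
  then have "openin (top_of_set (Cn p)) (V \<inter> f -` ball 0 ?B)"
    using V openin_trans by blast
  then obtain U where U: "open U" "V \<inter> f -` ball 0 ?B = Cn p \<inter> U"
    by (auto simp: openin_open)
  \<comment> \<open>Joint continuity in the point and the increment yields a box
    \<open>W \<times> H\<close> around \<open>(x, 0)\<close>, hence a radius \<open>R\<close> valid
    for all \<open>y\<close> in \<open>W\<close> at once.\<close>
  have "continuous_on UNIV (\<lambda>u :: point \<times> complex. (fst u)(i := fst u i + snd u))"
    by (intro continuous_on_shift continuous_on_fst continuous_on_snd continuous_on_id)
  then have "open ((\<lambda>(y, h). y(i := y i + h)) -` U)"
    unfolding split_def using U(1) by (rule open_vimage[rotated])
  moreover have "(x, 0) \<in> (\<lambda>(y, h). y(i := y i + h)) -` U"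
    using U x VC by auto
  ultimately obtain W H where W: "open W" "open H" "x \<in> W" "0 \<in> H"
      "W \<times> H \<subseteq> (\<lambda>(y, h). y(i := y i + h)) -` U"
    by (smt (verit, best) open_prod_elim mem_Times_iff fst_conv snd_conv)
  obtain R where R: "0 < R" "ball 0 R \<subseteq> H"
    using W open_contains_ball by blast
  have in_V: "y(i := y i + h) \<in> V \<and> cmod (f (y(i := y i + h))) \<le> ?B"
    if "y \<in> W \<inter> Cn p" "cmod h < R" for y h
  proof -
    have "(y, h) \<in> W \<times> H"
      using that R by auto
    then have "y(i := y i + h) \<in> Cn p \<inter> U"
      using W fun_upd_Cn i that by auto
    then have "y(i := y i + h) \<in> V \<inter> f -` ball 0 ?B"
      using U by simp
    then show ?thesis by auto
  qed
  show ?thesis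
  proof
    \<comment> \<open>The one-variable estimate on the disc of radius \<open>R\<close> covers only
      increments up to \<open>R / 4\<close>.\<close>
    show "0 < R / 4" using R by simp
    show "W \<inter> Cn p \<subseteq> V"
    proof
      fix y assume "y \<in> W \<inter> Cn p"
      then show "y \<in> V" using in_V[of y 0] R by simp
    qed
    fix y h assume y: "y \<in> W \<inter> Cn p" and h: "cmod h < R / 4"
    show "y(i := y i + h) \<in> V"
      using in_V[OF y, of h] h R by simp
    assume "h \<noteq> 0"
    let ?g = "\<lambda>w. f (y(i := y i + w))"
    have slice: "open {z. y(i := z) \<in> V}" "(\<lambda>z. f (y(i := z))) holomorphic_on {z. y(i := z) \<in> V}"
      using holomorphic_on_slice[OF V f i, of y] y by auto
    have "((\<lambda>z. f (y(i := z))) \<circ> (\<lambda>w. y i + w)) holomorphic_on ball 0 R"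
    proof (rule holomorphic_on_compose_gen[OF _ slice(2)])
      show "(\<lambda>w. y i + w) ` ball 0 R \<subseteq> {z. y(i := z) \<in> V}"
        using in_V[OF y] by (intro image_subsetI) simp
    qed (intro holomorphic_intros)
    then have g: "?g holomorphic_on ball 0 R"
      by (simp add: o_def)
    have "deriv ((\<lambda>z. f (y(i := z))) \<circ> (\<lambda>w. y i + w)) 0 = partial i f y"
    proof -
      have "(\<lambda>z. f (y(i := z))) field_differentiable at (y i + 0)"
        by (rule holomorphic_on_imp_differentiable_at[OF slice(2,1)])
          (use in_V[OF y, of 0] R in auto)
      then show ?thesis
        by (subst deriv_chain) (auto simp: partial_def intro!: derivative_intros)
    qed
    then have "deriv ?g 0 = partial i f y"
      by (simp add: o_def)
    with difference_quotient_error[OF g, of ?B h] in_V[OF y] h \<open>h \<noteq> 0\<close>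
    show "cmod ((f (y(i := y i + h)) - f y) / h - partial i f y) \<le> 32 * ?B / R\<^sup>2 * cmod h"
      by simp
  qed (use W in auto)
qed

text \<open>Difference quotients are continuous and separately holomorphic, and they converge locally
  uniformly.\<close>

lemma multi_holomorphic_partial:
  assumes V: "openin (top_of_set (Cn p)) V" and f: "multi_holomorphic p V f" and i: "i < p"
  shows "multi_holomorphic p V (partial i f)"
proof -
  have VC: "V \<subseteq> Cn p" by (rule openin_imp_subset[OF V])
  have f_cont: "continuous_on V f"
    using f by (simp add: multi_holomorphic_def)
  have "continuous (at x within V) (partial i f) \<and>
      (\<forall>k<p. (\<lambda>z. partial i f (x(k := z))) field_differentiable at (x k))" if x: "x \<in> V" for x
  proof -
    obtain W r K where W: "open W" "x \<in> W" "W \<inter> Cn p \<subseteq> V" "(0::real) < r"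
      and in_V: "\<And>y h. y \<in> W \<inter> Cn p \<Longrightarrow> cmod h < r \<Longrightarrow> y(i := y i + h) \<in> V"
      and err: "\<And>y h. y \<in> W \<inter> Cn p \<Longrightarrow> h \<noteq> 0 \<Longrightarrow> cmod h < r \<Longrightarrow>
        cmod ((f (y(i := y i + h)) - f y) / h - partial i f y) \<le> K * cmod h"
      using partial_locally_uniform[OF V f i x] by blast
    \<comment> \<open>The summand 2 keeps the increment strictly below \<open>r\<close> in norm
      already for \<open>n = 0\<close>.\<close>
    define h :: "nat \<Rightarrow> complex" where "h n = of_real (r / (real n + 2))" for n
    define q where "q n y = (f (y(i := y i + h n)) - f y) / h n" for n y
    have norm_h: "cmod (h n) = r / (real n + 2)" for n
      using W(4) unfolding h_def norm_of_real by simp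
    have h: "h n \<noteq> 0" "cmod (h n) < r" for n
    proof -
      have "cmod (h n) > 0"
        unfolding norm_h using W(4) by simp
      then show "h n \<noteq> 0" by simp
      have "r * 1 < r * (real n + 2)"
        using W(4) by (intro mult_strict_left_mono) auto
      then show "cmod (h n) < r"
        unfolding norm_h by (simp add: field_simps)
    qed
    have err_0: "(\<lambda>n. K * cmod (h n)) \<longlonglongrightarrow> K * 0"
    proof (intro tendsto_intros)
      have "(\<lambda>n. r / (real n + 2)) \<longlonglongrightarrow> 0" by real_asymp
      then show "(\<lambda>n. cmod (h n)) \<longlonglongrightarrow> 0" by (simp add: norm_h)
    qed
    have lim: "uniform_limit (W \<inter> Cn p) q (partial i f) sequentially"
      unfolding uniform_limit_iff
    proof safe
      fix e :: real assume "0 < e"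
      with err_0 have "\<forall>\<^sub>F n in sequentially. K * cmod (h n) < e"
        by (intro order_tendstoD) auto
      then show "\<forall>\<^sub>F n in sequentially. \<forall>y\<in>W \<inter> Cn p. dist (q n y) (partial i f y) < e"
      proof eventually_elim
        case (elim n)
        show ?case
        proof
          fix y assume "y \<in> W \<inter> Cn p"
          from err[OF this h, of n] elim show "dist (q n y) (partial i f y) < e"
            unfolding q_def dist_norm by linarith
        qed
      qed
    qed
    have "continuous_on (W \<inter> Cn p) (partial i f)"
    proof (rule uniform_limit_theorem[OF _ lim])
      have "continuous_on (W \<inter> Cn p) (q n)" for n
      proof -
        have "continuous_on (W \<inter> Cn p) (\<lambda>y. f (y(i := y i + h n)))"
          by (rule continuous_on_compose2[OF f_cont])
            (use in_V h in \<open>auto intro!: continuous_on_shift continuous_on_id continuous_on_const\<close>)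
        moreover have "continuous_on (W \<inter> Cn p) f"
          using f_cont W(3) by (rule continuous_on_subset)
        ultimately show ?thesis
          unfolding q_def by (intro continuous_intros) (use h in auto)
      qed
      then show "\<forall>\<^sub>F n in sequentially. continuous_on (W \<inter> Cn p) (q n)" by simp
    qed simp
    then have "continuous (at x within W \<inter> Cn p) (partial i f)"
      using x W VC by (auto simp: continuous_on_eq_continuous_within)
    \<comment> \<open>Inside the neighbourhood \<open>W\<close> the sets \<open>V\<close> and
      \<open>W \<inter> Cn p\<close> coincide, so they give the same filter at
      \<open>x\<close>.\<close>
    moreover have "at x within V = at x within W \<inter> Cn p"
      by (rule at_within_nhd[of _ W]) (use W VC in auto)
    ultimately have "continuous (at x within V) (partial i f)" by simp
    moreover have "(\<lambda>z. partial i f (x(k := z))) field_differentiable at (x k)" if k: "k < p" for k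
    proof -
      \<comment> \<open>Along the \<open>k\<close>-th slice, the limit of the holomorphic functions
        \<open>q n\<close> is holomorphic by Weierstrass' theorem.\<close>
      define Z where "Z = {z. x(k := z) \<in> W}"
      have "x \<in> Cn p" using x VC by auto
      note C = fun_upd_Cn[OF this k]
      have "open ((\<lambda>z. x(k := z)) -` W)"
        by (intro open_vimage W continuous_on_fun_upd continuous_on_const continuous_on_id)
      then have Z: "open Z" by (simp add: Z_def vimage_def)
      have "(\<lambda>z. partial i f (x(k := z))) holomorphic_on Z"
      proof (rule holomorphic_uniform_sequence[OF Z])
        show "(\<lambda>z. q n (x(k := z))) holomorphic_on Z" for n
        proof -
          have 1: "(\<lambda>z. f (x(k := z))) holomorphic_on Z"
            by (rule holomorphic_on_subset[OF holomorphic_on_slice(2)[OF V f k \<open>x \<in> Cn p\<close>]])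
              (use W C in \<open>auto simp: Z_def\<close>)
          have "(\<lambda>z. f ((x(k := z))(i := (x(k := z)) i + h n))) holomorphic_on Z"
          \<comment> \<open>If \<open>k = i\<close>, the increment translates the slice variable
            itself. Otherwise it only replaces the slice by the parallel one through the shifted
            point.\<close>
          proof (cases "k = i")
            case True
            have "((\<lambda>z. f (x(k := z))) \<circ> (\<lambda>z. z + h n)) holomorphic_on Z"
            proof (rule holomorphic_on_compose_gen[OF _ holomorphic_on_slice(2)[OF V f k \<open>x \<in> Cn p\<close>]])
              show "(\<lambda>z. z + h n) ` Z \<subseteq> {z. x(k := z) \<in> V}"
              proof (intro image_subsetI CollectI)
                fix z assume "z \<in> Z"
                then show "x(k := z + h n) \<in> V"
                  using in_V[of "x(k := z)" "h n"] C h True by (simp add: Z_def)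
              qed
            qed (intro holomorphic_intros)
            then show ?thesis using True by (simp add: o_def)
          next
            case False
            let ?x = "x(i := x i + h n)"
            have "?x \<in> Cn p"
              using \<open>x \<in> Cn p\<close> i by (rule fun_upd_Cn)
            have "(\<lambda>z. f (?x(k := z))) holomorphic_on Z"
            proof (rule holomorphic_on_subset[OF holomorphic_on_slice(2)[OF V f k \<open>?x \<in> Cn p\<close>]], intro subsetI CollectI)
              fix z assume "z \<in> Z"
              then show "?x(k := z) \<in> V"
                using in_V[of "x(k := z)" "h n"] C h False by (simp add: Z_def fun_upd_twist)
            qed
            then show ?thesis using False by (simp add: fun_upd_twist)
          qed
          with 1 show ?thesis
            unfolding q_def by (intro holomorphic_intros) (use h in auto)
        qed
        fix z assume "z \<in> Z"
        then obtain d where "0 < d" "cball z d \<subseteq> Z"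
          using Z open_contains_cball by blast
        moreover have "uniform_limit Z (\<lambda>n z. q n (x(k := z))) (\<lambda>z. partial i f (x(k := z))) sequentially"
          using lim C unfolding uniform_limit_iff Z_def by (auto elim!: eventually_mono)
        ultimately show "\<exists>d>0. cball z d \<subseteq> Z \<and>
            uniform_limit (cball z d) (\<lambda>n z. q n (x(k := z))) (\<lambda>z. partial i f (x(k := z))) sequentially"
          using uniform_limit_on_subset by blast
      qed
      moreover have "x k \<in> Z" using W by (simp add: Z_def)
      ultimately show ?thesis
        using Z holomorphic_on_imp_differentiable_at by blast
    qed
    ultimately show ?thesis by blast
  qed
  then show ?thesis
    by (simp add: multi_holomorphic_def continuous_on_eq_continuous_within)
qed

section \<open>Rescaling of derivatives, exterior products and substitutions\<close>

text \<open>The derivative along a slice depends only on the germ, and slices of \<open>V\<close>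
  are open, so proportionality on \<open>V\<close> is enough.\<close>

lemma partial_cmult:
  assumes V: "openin (top_of_set (Cn p)) V" and f: "multi_holomorphic p V f" and i: "i < p"
    and g: "\<And>y. y \<in> V \<Longrightarrow> g y = c * f y" and x: "x \<in> V"
  shows "partial i g x = c * partial i f x"
proof -
  have "x \<in> Cn p" using openin_imp_subset[OF V] x by auto
  note slice = holomorphic_on_slice[OF V f i this]
  have "\<forall>\<^sub>F z in nhds (x i). g (x(i := z)) = c * f (x(i := z))"
    using eventually_nhds_in_open[OF slice(1), of "x i"] x by (auto elim!: eventually_mono intro: g)
  then have "deriv (\<lambda>z. g (x(i := z))) (x i) = deriv (\<lambda>z. c * f (x(i := z))) (x i)"
    by (rule deriv_cong_ev) simp
  also have "\<dots> = c * deriv (\<lambda>z. f (x(i := z))) (x i)"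
    by (rule deriv_cmult, rule holomorphic_on_imp_differentiable_at[OF slice(2,1)]) (use x in auto)
  finally show ?thesis by (simp add: partial_def)
qed

text \<open>The induction over the differentiations carries holomorphy of the derivative of
  \<open>f\<close> along with the equation, since \<open>partial_cmult\<close> asks for it at each
  stage.\<close>

lemma multi_partial_cmult:
  assumes V: "openin (top_of_set (Cn p)) V" and f: "multi_holomorphic p V f"
    and g: "\<And>y. y \<in> V \<Longrightarrow> g y = c * f y" and x: "x \<in> V"
  shows "multi_partial p k g x = c * multi_partial p k f x"
proof -
  have pow: "multi_holomorphic p V ((partial i ^^ n) f) \<and>
      (\<forall>y\<in>V. (partial i ^^ n) g y = c * (partial i ^^ n) f y)"
    if "i < p" "multi_holomorphic p V f" "\<forall>y\<in>V. g y = c * f y" for i n f g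
    using that by (induction n) (auto intro: multi_holomorphic_partial[OF V] partial_cmult[OF V])
  have "multi_holomorphic p V (foldr (\<lambda>i. partial i ^^ k i) is f) \<and>
      (\<forall>y\<in>V. foldr (\<lambda>i. partial i ^^ k i) is g y = c * foldr (\<lambda>i. partial i ^^ k i) is f y)"
    if "set is \<subseteq> {..<p}" for "is"
    using that
  proof (induction "is")
    case (Cons i "is")
    then show ?case 
      using pow[of i "foldr (\<lambda>i. partial i ^^ k i) is f" "foldr (\<lambda>i. partial i ^^ k i) is g" "k i"]
      by simp
  qed (use f g in auto)
  from this[of "[0..<p]"] show ?thesis
    using x by (simp add: multi_partial_def atLeast0LessThan)
qed

text \<open>Degrees of complementary parts \<open>J\<close> and \<open>I - J\<close> add up, so
  multiplying degree \<open>d\<close> by \<open>z^d\<close> is multiplicative; the constants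
  \<open>a\<close> and \<open>b\<close> come out by bilinearity.\<close>

lemma gmul_rescale:
  "gmul (\<lambda>I. a * z ^ card I * u I) (\<lambda>I. b * z ^ card I * v I) I = a * b * z ^ card I * gmul u v I"
\<comment> \<open>For infinite \<open>I\<close> the sum over \<open>Pow I\<close> takes its default
  value 0 on both sides.\<close>
proof (cases "finite I")
  case True
  have "koszul_sign J (I - J) * (a * z ^ card J * u J) * (b * z ^ card (I - J) * v (I - J)) =
      a * b * z ^ card I * (koszul_sign J (I - J) * u J * v (I - J))" if "J \<in> Pow I" for J
  proof -
    have "card I = card J + card (I - J)"
      using that True by (simp add: card_Diff_subset card_mono finite_subset)
    then show ?thesis by (simp add: power_add)
  qed
  then show ?thesis
    unfolding gmul_def sum_distrib_left by (intro sum.cong) auto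
qed (simp add: gmul_def)

text \<open>The constant \<open>a\<close> accumulates once per factor, whereas the power of
  \<open>z\<close> sees only the total degree. Odd components will use
  \<open>a = inverse z\<close>.\<close>

lemma gprod_rescale:
  "gprod (map (\<lambda>u I. a * z ^ card I * u I) us) = (\<lambda>I. a ^ length us * z ^ card I * gprod us I)"
proof (induction us)
  case (Cons u us)
  have "gprod (v # vs) = gmul v (gprod vs)" for v vs
    by (simp add: gprod_def)
  then show ?case
    using gmul_rescale[of a z u "a ^ length us"] by (simp add: Cons fun_eq_iff)
qed (auto simp: gprod_def gone_def)

text \<open>Substitution is compatible with conjugation by
  \<open>\<theta> \<mapsto> z \<theta>\<close>. In the Taylor term for \<open>J\<close>, the factor
  \<open>z ^ card J\<close> of \<open>F' J\<close> cancels against the \<open>card J\<close> factors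
  \<open>inverse z\<close> of the odd components, and the products of components leave
  \<open>z ^ card I\<close>. The body has degree zero, so derivatives are taken at the same point.
  The constant \<open>k\<close> allows \<open>F\<close> to be itself an odd component of a
  transition map.\<close>

lemma pull_rescale:
  assumes z: "z \<noteq> 0" and V: "openin (top_of_set (Cn p)) V" and x: "body p r x \<in> V"
    and F: "\<And>J. J \<subseteq> {..<q} \<Longrightarrow> multi_holomorphic p V (F J)"
    and F': "\<And>J y. J \<subseteq> {..<q} \<Longrightarrow> y \<in> V \<Longrightarrow> F' J y = k * z ^ card J * F J y"
    and r': "\<And>c I. c \<in> coords p q \<Longrightarrow> r' c I x = (if isl c then 1 else inverse z) * z ^ card I * r c I x"
  shows "pull p q r' F' I x = k * z ^ card I * pull p q r F I x"
proof -
  have body: "body p r' x = body p r x"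
    using r' by (auto simp: body_def coords_def)
  let ?e = "\<lambda>r m. concat (map (\<lambda>i. replicate (m i) (soul (\<lambda>K. r (Inl i) K x))) [0..<p])"
  let ?o = "\<lambda>r J. map (\<lambda>a K. r (Inr a) K x) (sorted_list_of_set J)"
  have even: "?e r' m = map (\<lambda>u I. 1 * z ^ card I * u I) (?e r m)" for m
  proof -
    have "soul (\<lambda>K. r' (Inl i) K x) = (\<lambda>I. 1 * z ^ card I * soul (\<lambda>K. r (Inl i) K x) I)" if "i < p" for i
      using r'[of "Inl i"] that by (auto simp: soul_def coords_def)
    then show ?thesis
      unfolding map_concat map_map by (intro arg_cong[of _ _ concat] map_cong) auto
  qed
  have odd: "?o r' J = map (\<lambda>u I. inverse z * z ^ card I * u I) (?o r J)" if "J \<subseteq> {..<q}" for J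
    using r'[of "Inr a" for a] finite_subset[OF that] that by (auto simp: coords_def)
  have "multi_partial p m (F' J) (body p r' x) / (\<Prod>i<p. fact (m i)) *
        gmul (gprod (?e r' m)) (gprod (?o r' J)) I
      = k * z ^ card I * (multi_partial p m (F J) (body p r x) / (\<Prod>i<p. fact (m i)) *
        gmul (gprod (?e r m)) (gprod (?o r J)) I)" if J: "J \<subseteq> {..<q}" for J m
  proof -
    have "gmul (gprod (?e r' m)) (gprod (?o r' J)) I =
        inverse z ^ card J * z ^ card I * gmul (gprod (?e r m)) (gprod (?o r J)) I"
      unfolding even odd[OF J] gprod_rescale gmul_rescale by simp
    moreover have "multi_partial p m (F' J) (body p r' x) =
        k * z ^ card J * multi_partial p m (F J) (body p r x)"
      unfolding body by (rule multi_partial_cmult[OF V F F' x]) (use J in auto)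
    ultimately show ?thesis
      using z by (simp add: field_simps)
  qed
  then show ?thesis
    unfolding pull_def sum_distrib_left by (intro sum.cong refl) auto
qed

section \<open>Fibers over nonzero parameters as supermanifolds\<close>

lemma superfuns_cmult:
  assumes "F \<in> superfuns p q V" "\<And>I x. G I x = k I * F I x"
  shows "G \<in> superfuns p q V"
proof -
  have "G = (\<lambda>I x. k I * F I x)"
    using assms(2) by auto
  then show ?thesis
    using assms(1) by (auto simp: superfuns_def intro: multi_holomorphic_cmult)
qed

text \<open>Supplies the relatively open coordinate domains on which \<open>pull_rescale\<close>
  differentiates.\<close>

lemma openin_chart_image:
  assumes "complex_atlas N" "\<alpha> \<in> indices N" "openin (reduced_space N) W"
  shows "openin (top_of_set (Cn (evdim N))) (chart N \<alpha> ` (W \<inter> patch N \<alpha>))"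
proof -
  have "open_map (subtopology (reduced_space N) (patch N \<alpha>))
      (top_of_set (chart N \<alpha> ` patch N \<alpha>)) (chart N \<alpha>)"
    using assms by (simp add: complex_atlas_def homeomorphic_imp_open_map)
  moreover have "openin (subtopology (reduced_space N) (patch N \<alpha>)) (W \<inter> patch N \<alpha>)"
    using assms(3) by (auto simp: openin_subtopology)
  ultimately have "openin (top_of_set (chart N \<alpha> ` patch N \<alpha>)) (chart N \<alpha> ` (W \<inter> patch N \<alpha>))"
    by (simp add: open_map_def)
  moreover have "openin (top_of_set (Cn (evdim N))) (chart N \<alpha> ` patch N \<alpha>)"
    using assms by (simp add: complex_atlas_def)
  ultimately show ?thesis
    by (rule openin_trans)
qed

lemma openin_overlap:
  assumes "complex_atlas N" "\<alpha> \<in> indices N" "\<beta> \<in> indices N"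
  shows "openin (top_of_set (Cn (evdim N))) (overlap N \<alpha> \<beta>)"
  using openin_chart_image[OF assms(1,2), of "patch N \<beta>"] assms
  by (simp add: complex_atlas_def overlap_def Int_commute)

text \<open>Identifies the reduced space of a fiber with that of \<open>M\<close>, and through it
  the reduced spaces of two fibers.\<close>

lemma homeomorphic_maps_slice:
  assumes "t \<in> topspace Y"
  shows "homeomorphic_maps (subtopology (prod_topology X Y) {y. snd y = t}) X fst (\<lambda>m. (m, t))"
  using assms unfolding homeomorphic_maps_def
  by (auto simp: continuous_map_in_subtopology continuous_map_pairwise o_def
      intro: continuous_map_from_subtopology continuous_map_fst)

text \<open>Fiber charts are those of \<open>M\<close> after forgetting the parameter; this carries
  coordinate domains from one fiber to another.\<close>

lemma chart_image_fiber_rothstein: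
  assumes M: "supermanifold M" "\<alpha> \<in> indices M" and S: "S \<subseteq> patch M \<alpha> \<times> {t}"
  shows "chart (fiber (rothstein_family M) t) \<alpha> ` S = chart M \<alpha> ` {m. (m, t) \<in> S}"
proof -
  have "S = (\<lambda>m. (m, t)) ` {m. (m, t) \<in> S}"
    using S by auto
  then have "chart (fiber (rothstein_family M) t) \<alpha> ` S =
      (\<lambda>m. chart (fiber (rothstein_family M) t) \<alpha> (m, t)) ` {m. (m, t) \<in> S}"
    by (metis image_image)
  also have "\<dots> = chart M \<alpha> ` {m. (m, t) \<in> S}"
    using S by (intro image_cong) (auto simp: chart_fiber_rothstein[OF M])
  finally show ?thesis .
qed

lemma complex_atlas_fiber_rothstein:
  assumes M: "supermanifold M"
  shows "complex_atlas (fiber (rothstein_family M) t)"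
proof -
  let ?N = "fiber (rothstein_family M) t"
  let ?X = "reduced_space M"
  have at: "complex_atlas M" using M by (simp add: supermanifold_def)
  have top: "topspace (reduced_space ?N) = topspace ?X \<times> {t}"
    by auto
  have slice: "homeomorphic_map (reduced_space ?N) ?X fst"
    using homeomorphic_maps_slice[of t euclidean ?X] by (simp add: homeomorphic_maps_map)
  have P: "chart ?N \<alpha> ` patch ?N \<alpha> = chart M \<alpha> ` patch M \<alpha>" if "\<alpha> \<in> indices M" for \<alpha>
    using chart_image_fiber_rothstein[OF M that, of "patch ?N \<alpha>" t] by simp
  have "Hausdorff_space (reduced_space ?N)"
    using at by (auto simp: complex_atlas_def Hausdorff_space_prod_topology intro!: Hausdorff_space_subtopology)
  moreover have "topspace (reduced_space ?N) = (\<Union>\<alpha>\<in>indices ?N. patch ?N \<alpha>)"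
    unfolding top using at by (auto simp: complex_atlas_def)
  moreover have "openin (reduced_space ?N) (patch ?N \<alpha>)" if "\<alpha> \<in> indices M" for \<alpha>
  proof -
    have "openin (prod_topology ?X euclidean) (patch M \<alpha> \<times> (UNIV :: complex set))"
      using at that by (simp add: complex_atlas_def openin_prod_Times_iff)
    moreover have "patch M \<alpha> \<times> {t} = (patch M \<alpha> \<times> UNIV) \<inter> {y. snd y = t}"
      by auto
    ultimately show ?thesis
      unfolding fiber_rothstein_simps openin_subtopology by blast
  qed
  moreover have "openin (top_of_set (Cn (evdim ?N))) (chart ?N \<alpha> ` patch ?N \<alpha>)"
    if "\<alpha> \<in> indices M" for \<alpha>
    unfolding P[OF that] using at that by (simp add: complex_atlas_def)
  moreover have "homeomorphic_map (subtopology (reduced_space ?N) (patch ?N \<alpha>))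
      (top_of_set (chart ?N \<alpha> ` patch ?N \<alpha>)) (chart ?N \<alpha>)" if "\<alpha> \<in> indices M" for \<alpha>
  proof (rule homeomorphic_map_eq)
    have sub: "patch M \<alpha> \<subseteq> topspace ?X"
      using at that by (auto simp: complex_atlas_def)
    have "homeomorphic_map (subtopology (reduced_space ?N) (patch ?N \<alpha>)) (subtopology ?X (patch M \<alpha>)) fst"
    proof (rule homeomorphic_map_subtopologies[OF slice])
      have "(topspace ?X \<times> {t}) \<inter> (patch M \<alpha> \<times> {t}) = patch M \<alpha> \<times> {t}"
        using sub by blast
      then show "fst ` (topspace (reduced_space ?N) \<inter> patch ?N \<alpha>) = topspace ?X \<inter> patch M \<alpha>"
        unfolding top fiber_rothstein_simps(5) using sub by (simp add: Int_absorb1)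
    qed
    moreover have "homeomorphic_map (subtopology ?X (patch M \<alpha>))
        (top_of_set (chart M \<alpha> ` patch M \<alpha>)) (chart M \<alpha>)"
      using at that by (simp add: complex_atlas_def)
    ultimately show "homeomorphic_map (subtopology (reduced_space ?N) (patch ?N \<alpha>))
      (top_of_set (chart ?N \<alpha> ` patch ?N \<alpha>)) (chart M \<alpha> \<circ> fst)"
      unfolding P[OF that] by (rule homeomorphic_map_compose)
    show "(chart M \<alpha> \<circ> fst) y = chart ?N \<alpha> y"
      if "y \<in> topspace (subtopology (reduced_space ?N) (patch ?N \<alpha>))" for y
    proof (cases y)
      case (Pair m s)
      then have "m \<in> patch M \<alpha>"
        using that by auto
      then show ?thesis
        using Pair by (simp add: chart_fiber_rothstein[OF M \<open>\<alpha> \<in> indices M\<close>])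
    qed
  qed
  ultimately show ?thesis
    unfolding complex_atlas_def by simp
qed

text \<open>By parity, \<open>t\<close> to the power \<open>2\<lfloor>k/2\<rfloor>\<close> may be replaced by \<open>t\<^sup>k\<close> in the even components and by
  \<open>t\<^sup>k\<^sup>-\<^sup>1\<close> in the odd ones.\<close>

lemma transition_fiber_conjugate:
  assumes M: "supermanifold M" "\<alpha> \<in> indices M" "\<beta> \<in> indices M" "c \<in> coords (evdim M) (oddim M)"
    and t: "t \<noteq> 0"
  shows "transition (fiber (rothstein_family M) t) \<alpha> \<beta> c I x =
           (if isl c then 1 else inverse t) * t ^ card I * transition M \<alpha> \<beta> c I x"
proof (cases "transition M \<alpha> \<beta> c I x = 0")
  case False
  have "parity_preserving (evdim M) (oddim M) (transition M \<alpha> \<beta>)"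
    using M unfolding supermanifold_def by blast
  with False M(4) have "even (card I) \<longleftrightarrow> isl c"
    by (auto simp: parity_preserving_def)
  then have "t ^ rothstein_weight (card I) = (if isl c then 1 else inverse t) * t ^ card I"
    using t by (auto simp: rothstein_weight_def elim!: evenE oddE)
  then show ?thesis
    by (simp add: transition_fiber_rothstein[OF M])
qed (simp add: transition_fiber_rothstein[OF M])

text \<open>Every axiom is transported from \<open>M\<close> through the conjugation by
  \<open>\<theta> \<mapsto> t \<theta>\<close>. Only the cocycle condition involves substitution,
  and there \<open>pull_rescale\<close> applies.\<close>

lemma supermanifold_fiber_rothstein:
  assumes M: "supermanifold M" and t: "t \<noteq> 0"
  shows "supermanifold (fiber (rothstein_family M) t)"
proof -
  let ?N = "fiber (rothstein_family M) t"
  let ?p = "evdim M" and ?q = "oddim M"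
  have at: "complex_atlas M" using M by (simp add: supermanifold_def)
  note T = transition_fiber_conjugate[OF M _ _ _ t]
  have sf: "transition M \<alpha> \<beta> c \<in> superfuns ?p ?q (overlap M \<alpha> \<beta>)"
    and pp: "parity_preserving ?p ?q (transition M \<alpha> \<beta>)"
    if "\<alpha> \<in> indices M" "\<beta> \<in> indices M" "c \<in> coords ?p ?q" for \<alpha> \<beta> c
    using M that unfolding supermanifold_def by blast+
  have bd: "body ?p (transition M \<alpha> \<beta>) (chart M \<alpha> m) = chart M \<beta> m"
    if "\<alpha> \<in> indices M" "\<beta> \<in> indices M" "m \<in> patch M \<alpha> \<inter> patch M \<beta>" for \<alpha> \<beta> m
    using M that unfolding supermanifold_def by blast
  have img: "chart ?N \<alpha> ` S = chart M \<alpha> ` {m. (m, t) \<in> S}"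
    if "\<alpha> \<in> indices M" "S \<subseteq> patch M \<alpha> \<times> {t}" for \<alpha> S
    using chart_image_fiber_rothstein[OF M that] .
  have sf': "transition ?N \<alpha> \<beta> c \<in> superfuns ?p ?q (overlap ?N \<alpha> \<beta>)"
    if "\<alpha> \<in> indices M" "\<beta> \<in> indices M" "c \<in> coords ?p ?q" for \<alpha> \<beta> c
    unfolding overlap_fiber_rothstein[OF M that(1)]
    by (rule superfuns_cmult[OF sf[OF that]]) (rule T[OF that])
  have pp': "parity_preserving ?p ?q (transition ?N \<alpha> \<beta>)"
    if "\<alpha> \<in> indices M" "\<beta> \<in> indices M" for \<alpha> \<beta>
    unfolding parity_preserving_def
  proof (intro ballI allI impI)
    fix c I x assume c: "c \<in> coords ?p ?q" and "transition ?N \<alpha> \<beta> c I x \<noteq> 0"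
    then have "transition M \<alpha> \<beta> c I x \<noteq> 0"
      by (auto simp: T[OF that])
    then show "even (card I) = isl c"
      using pp[OF that c] c by (auto simp: parity_preserving_def)
  qed
  have bd': "body ?p (transition ?N \<alpha> \<beta>) (chart ?N \<alpha> y) = chart ?N \<beta> y"
    if ind: "\<alpha> \<in> indices M" "\<beta> \<in> indices M" and y: "y \<in> patch ?N \<alpha> \<inter> patch ?N \<beta>" for \<alpha> \<beta> y
  proof -
    obtain m where m: "y = (m, t)" "m \<in> patch M \<alpha> \<inter> patch M \<beta>"
      using y by (cases y) auto
    have "body ?p (transition ?N \<alpha> \<beta>) x = body ?p (transition M \<alpha> \<beta>) x" for x
      unfolding body_def by (intro ext) (simp add: coords_def T[OF ind])
    then show ?thesis
      using m ind by (simp add: chart_fiber_rothstein[OF M] bd)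
  qed
  have unit:
      "\<And>i. i < ?p \<Longrightarrow> transition ?N \<alpha> \<alpha> (Inl i) I x = (if I = {} then x i else 0)"
      "\<And>a. a < ?q \<Longrightarrow> transition ?N \<alpha> \<alpha> (Inr a) I x = (if I = {a} then 1 else 0)"
    if "\<alpha> \<in> indices M" "x \<in> chart ?N \<alpha> ` patch ?N \<alpha>" for \<alpha> x I
  proof -
    have "x \<in> chart M \<alpha> ` patch M \<alpha>"
      using that img[OF that(1), of "patch ?N \<alpha>"] by simp
    then have "(\<forall>i<?p. transition M \<alpha> \<alpha> (Inl i) I x = (if I = {} then x i else 0)) \<and>
     (\<forall>a<?q. transition M \<alpha> \<alpha> (Inr a) I x = (if I = {a} then 1 else 0))"
      using M that(1) unfolding supermanifold_def by blast
    \<comment> \<open>The identity survives: an even coordinate sits in degree 0, and an odd one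
      gets the factor \<open>inverse t * t\<close>.\<close>
    then show "\<And>i. i < ?p \<Longrightarrow> transition ?N \<alpha> \<alpha> (Inl i) I x = (if I = {} then x i else 0)"
      and "\<And>a. a < ?q \<Longrightarrow> transition ?N \<alpha> \<alpha> (Inr a) I x = (if I = {a} then 1 else 0)"
      using t by (simp_all add: T[OF that(1,1)] coords_def)
  qed
  have cocycle: "transition ?N \<alpha> \<gamma> c I x = pull ?p ?q (transition ?N \<alpha> \<beta>) (transition ?N \<beta> \<gamma> c) I x"
    if ind: "\<alpha> \<in> indices M" "\<beta> \<in> indices M" "\<gamma> \<in> indices M"
      and x: "x \<in> chart ?N \<alpha> ` (patch ?N \<alpha> \<inter> patch ?N \<beta> \<inter> patch ?N \<gamma>)" and c: "c \<in> coords ?p ?q"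
    for \<alpha> \<beta> \<gamma> x c I
  proof -
    have "x \<in> chart M \<alpha> ` (patch M \<alpha> \<inter> patch M \<beta> \<inter> patch M \<gamma>)"
      using x img[OF ind(1), of "patch ?N \<alpha> \<inter> patch ?N \<beta> \<inter> patch ?N \<gamma>"] by auto
    then obtain m where m: "x = chart M \<alpha> m" "m \<in> patch M \<alpha> \<inter> patch M \<beta> \<inter> patch M \<gamma>"
      by blast
    have "transition M \<alpha> \<gamma> c I x = pull ?p ?q (transition M \<alpha> \<beta>) (transition M \<beta> \<gamma> c) I x"
      using M ind c m unfolding supermanifold_def by blast
    moreover have "pull ?p ?q (transition ?N \<alpha> \<beta>) (transition ?N \<beta> \<gamma> c) I x =
        (if isl c then 1 else inverse t) * t ^ card I *
          pull ?p ?q (transition M \<alpha> \<beta>) (transition M \<beta> \<gamma> c) I x"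
    \<comment> \<open>Here \<open>k\<close> is 1 or \<open>inverse t\<close> according to the parity
      of \<open>c\<close>, which is the factor conjugation puts on both
      \<open>transition ?N \<beta> \<gamma> c\<close> and
      \<open>transition ?N \<alpha> \<gamma> c\<close>.\<close>
    proof (rule pull_rescale[OF t openin_overlap[OF at ind(2,3)]])
      show "body ?p (transition M \<alpha> \<beta>) x \<in> overlap M \<beta> \<gamma>"
        using bd[OF ind(1,2), of m] m by (auto simp: overlap_def)
      show "multi_holomorphic ?p (overlap M \<beta> \<gamma>) (transition M \<beta> \<gamma> c J)" if "J \<subseteq> {..<?q}" for J
        using sf[OF ind(2,3) c] that by (simp add: superfuns_def)
    qed (use T ind c in auto)
    ultimately show ?thesis
      by (simp add: T[OF ind(1,3) c])
  qed
  show ?thesis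
    unfolding supermanifold_def fiber_rothstein_simps(1-3)
    by (intro conjI ballI allI impI complex_atlas_fiber_rothstein[OF M] sf' pp' bd' unit cocycle)
qed

section \<open>Isomorphisms between the fibers\<close>

text \<open>Both fibers are conjugates of \<open>M\<close>, hence conjugate to each other with ratio
  \<open>z = t / t'\<close>, and \<open>pull_rescale\<close> with \<open>k = 1\<close> preserves the
  matching condition. Relating \<open>V\<close> and \<open>W\<close> only by corresponding points
  lets the lemma be reused with the two fibers exchanged.\<close>

lemma section_rescale:
  assumes M: "supermanifold M" and t: "t \<noteq> 0" "t' \<noteq> 0"
    and W: "openin (reduced_space (fiber (rothstein_family M) t')) W"
    and s: "s \<in> sections (fiber (rothstein_family M) t') W"
    and V: "\<And>m. (m, t) \<in> V \<longleftrightarrow> (m, t') \<in> W"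
  shows "(\<lambda>\<alpha> I x. (t / t') ^ card I * s \<alpha> I x) \<in> sections (fiber (rothstein_family M) t) V"
proof -
  let ?N = "fiber (rothstein_family M) t" and ?N' = "fiber (rothstein_family M) t'"
  let ?p = "evdim M" and ?q = "oddim M"
  let ?s = "\<lambda>\<alpha> I x. (t / t') ^ card I * s \<alpha> I x"
  have N': "supermanifold ?N'"
    by (rule supermanifold_fiber_rothstein[OF M t(2)])
  \<comment> \<open>The set \<open>A\<close> is \<open>patch M \<alpha>\<close> for the domain of a
    section and \<open>patch M \<beta>\<close> for overlaps.\<close>
  have img: "chart ?N \<alpha> ` (V \<inter> patch ?N \<alpha> \<inter> (A \<times> {t})) = chart ?N' \<alpha> ` (W \<inter> patch ?N' \<alpha> \<inter> (A \<times> {t'}))"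
    if "\<alpha> \<in> indices M" for \<alpha> A
    using chart_image_fiber_rothstein[OF M that, of "V \<inter> patch ?N \<alpha> \<inter> (A \<times> {t})" t]
      chart_image_fiber_rothstein[OF M that, of "W \<inter> patch ?N' \<alpha> \<inter> (A \<times> {t'})" t'] V
    by (simp add: le_infI1)
  have img1: "chart ?N \<alpha> ` (V \<inter> patch ?N \<alpha>) = chart ?N' \<alpha> ` (W \<inter> patch ?N' \<alpha>)"
    if "\<alpha> \<in> indices M" for \<alpha>
    using img[OF that, of "patch M \<alpha>"] by simp
  have sf: "s \<alpha> \<in> superfuns ?p ?q (chart ?N' \<alpha> ` (W \<inter> patch ?N' \<alpha>))" if "\<alpha> \<in> indices M" for \<alpha>
    using s that unfolding sections_def fiber_rothstein_simps by blast
  have "?s \<alpha> = (\<lambda>I x. 0)" if "\<alpha> \<notin> indices M" for \<alpha>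
    using s that by (simp add: sections_def)
  moreover have "?s \<alpha> \<in> superfuns ?p ?q (chart ?N \<alpha> ` (V \<inter> patch ?N \<alpha>))" if "\<alpha> \<in> indices M" for \<alpha>
    unfolding img1[OF that] by (rule superfuns_cmult[OF sf[OF that]]) (rule refl)
  moreover have "?s \<alpha> I x = pull ?p ?q (transition ?N \<alpha> \<beta>) (?s \<beta>) I x"
    if ind: "\<alpha> \<in> indices M" "\<beta> \<in> indices M"
      and x: "x \<in> chart ?N \<alpha> ` (V \<inter> patch ?N \<alpha> \<inter> patch ?N \<beta>)" for \<alpha> \<beta> I x
  proof -
    have x': "x \<in> chart ?N' \<alpha> ` (W \<inter> patch ?N' \<alpha> \<inter> patch ?N' \<beta>)"
      using x img[OF ind(1), of "patch M \<beta>"] by simp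
    then obtain y where y: "x = chart ?N' \<alpha> y" "y \<in> W \<inter> patch ?N' \<alpha> \<inter> patch ?N' \<beta>"
      by blast
    have "s \<alpha> I x = pull ?p ?q (transition ?N' \<alpha> \<beta>) (s \<beta>) I x"
      using s ind x' unfolding sections_def fiber_rothstein_simps by blast
    moreover have "pull ?p ?q (transition ?N \<alpha> \<beta>) (?s \<beta>) I x =
        1 * (t / t') ^ card I * pull ?p ?q (transition ?N' \<alpha> \<beta>) (s \<beta>) I x"
    proof (rule pull_rescale)
      show "openin (top_of_set (Cn ?p)) (chart ?N' \<beta> ` (W \<inter> patch ?N' \<beta>))"
        using openin_chart_image[OF complex_atlas_fiber_rothstein[OF M], of \<beta> t' W] ind W
        by (simp only: fiber_rothstein_simps)
      have "body ?p (transition ?N' \<alpha> \<beta>) x = chart ?N' \<beta> y"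
        using N' ind y unfolding supermanifold_def fiber_rothstein_simps by blast
      then show "body ?p (transition ?N' \<alpha> \<beta>) x \<in> chart ?N' \<beta> ` (W \<inter> patch ?N' \<beta>)"
        using y by blast
      show "multi_holomorphic ?p (chart ?N' \<beta> ` (W \<inter> patch ?N' \<beta>)) (s \<beta> J)" if "J \<subseteq> {..<?q}" for J
        using sf[OF ind(2)] that unfolding superfuns_def by blast
      show "transition ?N \<alpha> \<beta> c K x =
          (if isl c then 1 else inverse (t / t')) * (t / t') ^ card K * transition ?N' \<alpha> \<beta> c K x"
        if "c \<in> coords ?p ?q" for c K
        using t by (simp add: transition_fiber_conjugate[OF M ind that] field_simps)
    qed (use t in auto)
    ultimately show ?thesis by simp
  qed
  ultimately show ?thesis
    unfolding sections_def fiber_rothstein_simps by blast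
qed

text \<open>The isomorphism is the identity on \<open>X\<close> and rescales \<theta> by
  \<open>t / t'\<close>; its inverse rescales by \<open>t' / t\<close>.\<close>

lemma isomorphic_fibers_rothstein:
  fixes M :: "('x, 'a) supermfd"
  assumes M: "supermanifold M" and t: "t \<noteq> 0" "t' \<noteq> 0"
  shows "isomorphic_supermanifolds (fiber (rothstein_family M) t) (fiber (rothstein_family M) t')"
proof -
  let ?N = "fiber (rothstein_family M) t" and ?N' = "fiber (rothstein_family M) t'"
  define \<Phi> :: "'x \<times> complex \<Rightarrow> 'x \<times> complex" where "\<Phi> = (\<lambda>y. (fst y, t'))"
  \<comment> \<open>The formula ignores \<open>W\<close>, so compatibility with restriction reduces
    to matching coordinate domains.\<close>
  define \<psi> :: "('x \<times> complex) set \<Rightarrow> 'a sheaf_section \<Rightarrow> 'a sheaf_section"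
    where "\<psi> W s = (\<lambda>\<alpha> I x. (t / t') ^ card I * s \<alpha> I x)" for W s
  define pre where "pre W = {x \<in> topspace (reduced_space ?N). \<Phi> x \<in> W}" for W
  have pre: "(m, t) \<in> pre W \<longleftrightarrow> (m, t') \<in> W" if "openin (reduced_space ?N') W" for W m
    using openin_subset[OF that] by (auto simp: pre_def \<Phi>_def)
  have "homeomorphic_maps (reduced_space ?N) (reduced_space ?N')
      ((\<lambda>m. (m, t')) \<circ> fst) ((\<lambda>m. (m, t)) \<circ> fst)"
    unfolding fiber_rothstein_simps
    by (rule homeomorphic_maps_compose[OF conjI[OF homeomorphic_maps_slice
            homeomorphic_maps_slice[THEN homeomorphic_maps_sym[THEN iffD1]]]]) simp_all
  then have \<Phi>: "homeomorphic_map (reduced_space ?N) (reduced_space ?N') \<Phi>"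
    by (simp add: homeomorphic_maps_map \<Phi>_def o_def)
  have img: "chart ?N \<alpha> ` (pre W \<inter> patch ?N \<alpha>) = chart ?N' \<alpha> ` (W \<inter> patch ?N' \<alpha>)"
    if "\<alpha> \<in> indices M" "openin (reduced_space ?N') W" for \<alpha> W
    using chart_image_fiber_rothstein[OF M that(1), of "pre W \<inter> patch ?N \<alpha>" t]
      chart_image_fiber_rothstein[OF M that(1), of "W \<inter> patch ?N' \<alpha>" t'] pre[OF that(2)] by simp
  have inverse: "(t' / t) ^ n * ((t / t') ^ n * z) = z" "(t / t') ^ n * ((t' / t) ^ n * z) = z" for n z
    using t by (simp_all add: power_divide)
  have bij: "bij_betw (\<psi> W) (sections ?N' W) (sections ?N (pre W))"
    if W: "openin (reduced_space ?N') W" for W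
  proof (rule bij_betw_byWitness[where f' = "\<lambda>s \<alpha> I x. (t' / t) ^ card I * s \<alpha> I x"])
    \<comment> \<open>For the inverse direction \<open>section_rescale\<close> starts from sections
      over \<open>pre W\<close>, which must be open.\<close>
    have "openin (reduced_space ?N) (pre W)"
      unfolding pre_def using \<Phi> W homeomorphic_imp_continuous_map openin_continuous_map_preimage by blast
    then show "(\<lambda>s \<alpha> I x. (t' / t) ^ card I * s \<alpha> I x) ` sections ?N (pre W) \<subseteq> sections ?N' W"
      using section_rescale[OF M t(2,1)] pre[OF W] by blast
    show "\<psi> W ` sections ?N' W \<subseteq> sections ?N (pre W)"
      unfolding \<psi>_def using section_rescale[OF M t W] pre[OF W] by blast
  qed (auto simp: \<psi>_def inverse)
  have one: "\<psi> W (section_one ?N' W) = section_one ?N (pre W)"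
    if "openin (reduced_space ?N') W" for W
  proof -
    have "section_one ?N' W \<alpha> = section_one ?N (pre W) \<alpha>" for \<alpha>
      using img[OF _ that, of \<alpha>] by (cases "\<alpha> \<in> indices M") (simp_all add: section_one_def)
    moreover have "\<psi> W (section_one ?N' W) = section_one ?N' W"
      by (auto simp: \<psi>_def section_one_def gone_def fun_eq_iff)
    ultimately show ?thesis by auto
  qed
  have restrict: "\<psi> W' (restrict_section ?N' W' s) = restrict_section ?N (pre W') (\<psi> W s)"
    if "openin (reduced_space ?N') W'" "s \<in> sections ?N' W" for W W' s
  proof (intro ext)
    fix \<alpha> I x
    show "\<psi> W' (restrict_section ?N' W' s) \<alpha> I x = restrict_section ?N (pre W') (\<psi> W s) \<alpha> I x"
    proof (cases "\<alpha> \<in> indices M")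
      case True
      then show ?thesis
        using img[OF True that(1)] by (simp add: \<psi>_def restrict_section_def)
    next
      \<comment> \<open>Charts outside the index set are arbitrary, so the domains cannot be
        compared; but sections vanish there.\<close>
      case False
      then have "s \<alpha> = (\<lambda>I x. 0)"
        using that(2) by (simp add: sections_def)
      then show ?thesis
        by (simp add: \<psi>_def restrict_section_def)
    qed
  qed
  have nonzero: "s \<alpha> I x \<noteq> 0" if "\<psi> W s \<alpha> I x \<noteq> 0" for W s \<alpha> I x
    using that by (auto simp: \<psi>_def)
  have "supermanifold_isomorphism ?N ?N' \<Phi> \<psi>"
    unfolding supermanifold_isomorphism_def Let_def pre_def[symmetric]
  proof (intro conjI allI impI ballI \<Phi>)
    fix W s r assume "openin (reduced_space ?N') W"
    show "\<psi> W (section_mult s r) = section_mult (\<psi> W s) (\<psi> W r)"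
      using gmul_rescale[of 1 "t / t'" _ 1] by (simp add: \<psi>_def section_mult_def)
  next
    fix W and s :: "'a sheaf_section" assume "even_section s"
    then show "even_section (\<psi> W s)"
      using nonzero unfolding even_section_def by blast
  next
    fix W and s :: "'a sheaf_section" assume "odd_section s"
    then show "odd_section (\<psi> W s)"
      using nonzero unfolding odd_section_def by blast
  next
    fix W s r
    show "\<psi> W (section_add s r) = section_add (\<psi> W s) (\<psi> W r)"
      by (simp add: \<psi>_def section_add_def distrib_left)
  next
    fix W s z
    show "\<psi> W (section_scale z s) = section_scale z (\<psi> W s)"
      by (simp add: \<psi>_def section_scale_def mult.left_commute)
  qed (simp_all only: bij one restrict)
  then show ?thesis
    unfolding isomorphic_supermanifolds_def
    using supermanifold_fiber_rothstein[OF M] t by blast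
qed

theorem theorem1p5p4:
  fixes M :: "('x, 'a) supermfd" and j :: nat
  assumes "supermanifold M"
    and "1 < j"
    and "splitting_type M j"
  shows "generically_isotrivial (rothstein_family M) j (rothstein_section j)"
  \<comment> \<open>As \<open>1 < j\<close>, the exponent in \<open>rothstein_section j\<close> is
    positive, so the section is nonzero exactly at nonzero parameters, where the fibers are
    conjugates of \<open>M\<close>.\<close>
  unfolding generically_isotrivial_def
  using assms characteristic_section_rothstein isomorphic_fibers_rothstein rothstein_section_nonzero
  by blast

end
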